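(* Let $X,Y$ be Banach spaces, $f:X\to Y$ a continuous map and $Jf$ a pseudo-Jacobian mapping for $f$ on $X$ satisfying the chain rule condition on $X$. Suppose that $Jf$ is regular at every $x\in X$. Then the following conditions are equivalent: (a) $f:X\to Y$ is a global homeomorphism; (b) for each compact subset $K\subset Y$, $\inf\{\alpha_{Jf}(x) : x\in f^{-1}(K)\}>0$; (c) $f:X\to Y$ is a global homeomorphism with a locally Lipschitz inverse.
   Context: Banach spaces are real; $\mathcal{L}(X,Y)$ is the space of bounded linear operators from $X$ to $Y$; $B(x,r)$ denotes the open ball; $\mathrm{co}$ denotes convex hull; a global homeomorphism is a homeomorphism from $X$ onto $Y$; $\inf\emptyset=+\infty$. For $\varphi:U\to\mathbb{R}$ with $U\subset X$ open, $x\in U$ and $v\in X$, $\varphi'_{+}(x;v)=\limsup_{t\to0^+}\frac{\varphi(x+tv)-\varphi(x)}{t}$. For a map $f:U\to Y$ and $x\in U$, a nonempty set $Jf(x)\subset\mathcal{L}(X,Y)$ is a pseudo-Jacobian of $f$ at $x$ if $(y^*\circ f)'_{+}(x;v)\le\sup\{\langle y^*,T(v)\rangle : T\in Jf(x)\}$ for all $y^*\in Y^*$ and $v\in X$. (For real-valued functions, pseudo-Jacobians are subsets of $X^*$.) A set-valued mapping $Jf:U\to2^{\mathcal{L}(X,Y)}$ is a pseudo-Jacobian mapping for $f$ on $U$ if $Jf(x)$ is a pseudo-Jacobian of $f$ at $x$ for every $x\in U$. For $A\subset U$, $Jf(A)=\{T : T\in Jf(z),\ z\in A\}$. Chain rule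 condition: for $y\in Y$ let $d_y(v)=\|v-y\|$, $v\in Y$, and let $\partial d_y(v)$ be its Clarke subdifferential (which, $d_y$ being convex and Lipschitz, is the convex subdifferential $\{y^*\in Y^* : \|w-y\|\ge\|v-y\|+\langle y^*,w-v\rangle\ \forall w\in Y\}$). For $x\in U$, $y\in Y$, $y\ne f(x)$, let $A_{x,y}(f)=\{y^*\circ T : y^*\in\partial d_y(f(x)),\ T\in\overline{\mathrm{co}}(Jf(x))\}\subset X^*$, where $\overline{\mathrm{co}}$ is the operator-norm closed convex hull. $Jf$ satisfies the chain rule condition on $U$ if for each $x\in U$ and each $y\in Y$ with $y\neq f(x)$, the set $A_{x,y}(f)$ is a $w^*$-closed and convex pseudo-Jacobian of $d_y\circ f$ at $x$. Regularity: for $T\in\mathcal{L}(X,Y)$ put $c(T)=\inf_{\|x\|=1}\|Tx\|$ (co-norm). The regularity index of $Jf$ at $x$ is $\alpha_{Jf}(x)=\sup_{r>0}\inf\{c(T) : T\in\mathrm{co}\,Jf(B(x,r))\}$ (over $r$ with $B(x,r)\subset U$). $Jf$ is regular at $x$ if for some $r>0$ every $T\in\mathrm{co}\,Jf(B(x,r))$ is an isomorphism (bounded linear bijection from $X$ onto $Y$ with bounded inverse) and $\alpha_{Jf}(x)>0$. *)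

theory Defs
  imports "HOL-Analysis.Analysis"
begin

text \<open>Suprema, infima and upper limits are taken in \<open>ereal\<close>: a function that is merely
  continuous may have infinite upper derivatives, and the infimum over the empty set is
  \<open>\<infinity>\<close>.\<close>

definition upper_dini_deriv :: "('a::real_normed_vector \<Rightarrow> real) \<Rightarrow> 'a \<Rightarrow> 'a \<Rightarrow> ereal" where
  "upper_dini_deriv \<phi> x v =
     Limsup (at_right 0) (\<lambda>t::real. ereal ((\<phi> (x + t *\<^sub>R v) - \<phi> x) / t))"

definition pseudo_Jacobian ::
  "('a::real_normed_vector \<Rightarrow> 'b::real_normed_vector) \<Rightarrow> 'a \<Rightarrow> ('a \<Rightarrow>\<^sub>L 'b) set \<Rightarrow> bool" where
  "pseudo_Jacobian f x J \<longleftrightarrow>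
     J \<noteq> {} \<and>
     (\<forall>(ystar :: 'b \<Rightarrow>\<^sub>L real) v.
        upper_dini_deriv (blinfun_apply ystar \<circ> f) x v
          \<le> (SUP T\<in>J. ereal (blinfun_apply ystar (blinfun_apply T v))))"

text \<open>For open \<open>U\<close>, only the values of \<open>f\<close> and \<open>Jf\<close> on \<open>U\<close> matter.\<close>

definition pseudo_Jacobian_mapping ::
  "('a::real_normed_vector \<Rightarrow> 'b::real_normed_vector) \<Rightarrow> ('a \<Rightarrow> ('a \<Rightarrow>\<^sub>L 'b) set) \<Rightarrow> 'a set \<Rightarrow> bool" where
  "pseudo_Jacobian_mapping f Jf U \<longleftrightarrow> (\<forall>x\<in>U. pseudo_Jacobian f x (Jf x))"

definition clarke_deriv :: "('a::real_normed_vector \<Rightarrow> real) \<Rightarrow> 'a \<Rightarrow> 'a \<Rightarrow> ereal" where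
  "clarke_deriv \<phi> x v =
     Limsup (nhds x \<times>\<^sub>F at_right 0) (\<lambda>(z, t::real). ereal ((\<phi> (z + t *\<^sub>R v) - \<phi> z) / t))"

definition clarke_subdifferential ::
  "('a::real_normed_vector \<Rightarrow> real) \<Rightarrow> 'a \<Rightarrow> ('a \<Rightarrow>\<^sub>L real) set" where
  "clarke_subdifferential \<phi> x =
     {xstar. \<forall>v. ereal (blinfun_apply xstar v) \<le> clarke_deriv \<phi> x v}"

definition dist_to :: "'b::real_normed_vector \<Rightarrow> 'b \<Rightarrow> real" where
  "dist_to y v = norm (v - y)"

lemma clarke_subdifferential_dist_to:
  fixes y v :: "'b::real_normed_vector"
  shows "clarke_subdifferential (dist_to y) v =
    {ystar. \<forall>w. norm (w - y) \<ge> norm (v - y) + blinfun_apply ystar (w - v)}"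
proof (intro set_eqI iffI)
  fix p :: "'b \<Rightarrow>\<^sub>L real"
  assume "p \<in> clarke_subdifferential (dist_to y) v"
  then have p: "ereal (blinfun_apply p u) \<le> clarke_deriv (dist_to y) v u" for u
    by (simp add: clarke_subdifferential_def)
  have "blinfun_apply p u \<le> norm (v + u - y) - norm (v - y)" for u
  proof -
    let ?F = "nhds v \<times>\<^sub>F at_right (0::real)"
    let ?h = "\<lambda>(z, t::real). ereal (norm (z + u - y) - norm (z - y))"
    have nb: "?F \<noteq> bot"
      by (simp add: prod_filter_eq_bot)
    have "(fst \<longlongrightarrow> v) ?F"
      using filterlim_fst by blast
    then have "((\<lambda>q. norm (fst q + u - y) - norm (fst q - y))
        \<longlongrightarrow> norm (v + u - y) - norm (v - y)) ?F"
      by (intro tendsto_intros)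
    then have "(?h \<longlongrightarrow> ereal (norm (v + u - y) - norm (v - y))) ?F"
      by (simp add: case_prod_unfold)
    then have lim: "Limsup ?F ?h = ereal (norm (v + u - y) - norm (v - y))"
      using nb lim_imp_Limsup by blast
    have quot: "(norm (z + t *\<^sub>R u - y) - norm (z - y)) / t \<le> norm (z + u - y) - norm (z - y)"
      if "0 < t" "t < 1" for z and t :: real
    proof -
      have "z + t *\<^sub>R u - y = t *\<^sub>R (z + u - y) + (1 - t) *\<^sub>R (z - y)"
        by (simp add: algebra_simps)
      then have "norm (z + t *\<^sub>R u - y) \<le> t * norm (z + u - y) + (1 - t) * norm (z - y)"
        using that by (metis abs_of_pos diff_gt_0_iff_gt norm_scaleR norm_triangle_ineq)
      then show ?thesis
        using that by (simp add: divide_simps algebra_simps)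
    qed
    have "eventually (\<lambda>t::real. 0 < t \<and> t < 1) (at_right 0)"
      by (auto simp: eventually_at_right_field intro!: exI[of _ 1])
    then have "eventually (\<lambda>q. 0 < snd q \<and> snd q < 1) ?F"
      using filterlim_snd unfolding filterlim_iff by blast
    then have "clarke_deriv (dist_to y) v u \<le> Limsup ?F ?h"
      unfolding clarke_deriv_def dist_to_def
      by (intro Limsup_mono) (auto elim!: eventually_mono simp: quot)
    with p[of u] lim show ?thesis
      using order_trans by fastforce
  qed
  from this[of "w - v" for w]
  have "blinfun_apply p (w - v) \<le> norm (w - y) - norm (v - y)" for w
    by simp
  then show "p \<in> {ystar. \<forall>w. norm (w - y) \<ge> norm (v - y) + blinfun_apply ystar (w - v)}"
    by (simp add: algebra_simps)
next
  fix p :: "'b \<Rightarrow>\<^sub>L real"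
  assume "p \<in> {ystar. \<forall>w. norm (w - y) \<ge> norm (v - y) + blinfun_apply ystar (w - v)}"
  then have p: "norm (w - y) \<ge> norm (v - y) + blinfun_apply p (w - v)" for w
    by simp
  have "ereal (blinfun_apply p u) \<le> clarke_deriv (dist_to y) v u" for u
    unfolding clarke_deriv_def
  proof (rule Limsup_greatest)
    fix P
    assume "eventually P (nhds v \<times>\<^sub>F at_right (0::real))"
    then obtain Q R where Q: "eventually Q (nhds v)" and R: "eventually R (at_right (0::real))"
      and QR: "\<And>z t. Q z \<Longrightarrow> R t \<Longrightarrow> P (z, t)"
      unfolding eventually_prod_filter by blast
    have "eventually (\<lambda>t. R t \<and> 0 < t) (at_right (0::real))"
      using R eventually_at_right_less by (rule eventually_conj)
    then obtain t where t: "R t" "0 < t"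
      using eventually_happens'[OF trivial_limit_at_right_real] by blast
    have "P (v, t)"
      using QR eventually_nhds_x_imp_x[OF Q] t by blast
    moreover have "blinfun_apply p u \<le> (dist_to y (v + t *\<^sub>R u) - dist_to y v) / t"
      using p[of "v + t *\<^sub>R u"] t
      by (simp add: dist_to_def blinfun.scaleR_right divide_simps algebra_simps)
    ultimately show "ereal (blinfun_apply p u)
        \<le> (SUP q\<in>Collect P. case q of (z, t) \<Rightarrow> ereal ((dist_to y (z + t *\<^sub>R u) - dist_to y z) / t))"
      by (intro SUP_upper2[of "(v, t)"]) auto
  qed
  then show "p \<in> clarke_subdifferential (dist_to y) v"
    by (simp add: clarke_subdifferential_def)
qed

definition chain_set ::
  "('a::real_normed_vector \<Rightarrow> 'b::real_normed_vector) \<Rightarrow> ('a \<Rightarrow> ('a \<Rightarrow>\<^sub>L 'b) set) \<Rightarrow> 'a \<Rightarrow> 'b \<Rightarrow> ('a \<Rightarrow>\<^sub>L real) set" where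
  "chain_set f Jf x y =
     {ystar o\<^sub>L T | ystar T.
        ystar \<in> clarke_subdifferential (dist_to y) (f x) \<and> T \<in> closure (convex hull (Jf x))}"

text \<open>On \<open>'a \<Rightarrow>\<^sub>L real\<close>, the topology of pointwise convergence
  \<open>strong_operator_topology\<close> is the weak-star topology of the dual space.\<close>

definition chain_rule_condition ::
  "('a::real_normed_vector \<Rightarrow> 'b::real_normed_vector) \<Rightarrow> ('a \<Rightarrow> ('a \<Rightarrow>\<^sub>L 'b) set) \<Rightarrow> 'a set \<Rightarrow> bool" where
  "chain_rule_condition f Jf U \<longleftrightarrow>
     (\<forall>x\<in>U. \<forall>y. y \<noteq> f x \<longrightarrow>
        closedin strong_operator_topology (chain_set f Jf x y) \<and>
        convex (chain_set f Jf x y) \<and>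
        pseudo_Jacobian (dist_to y \<circ> f) x (chain_set f Jf x y))"

definition conorm :: "('a::real_normed_vector \<Rightarrow>\<^sub>L 'b::real_normed_vector) \<Rightarrow> ereal" where
  "conorm T = (INF x\<in>{x. norm x = 1}. ereal (norm (blinfun_apply T x)))"

definition regularity_index ::
  "('a::real_normed_vector \<Rightarrow> ('a \<Rightarrow>\<^sub>L 'b::real_normed_vector) set) \<Rightarrow> 'a set \<Rightarrow> 'a \<Rightarrow> ereal" where
  "regularity_index Jf U x =
     (SUP r\<in>{r. r > 0 \<and> ball x r \<subseteq> U}. INF T\<in>convex hull (\<Union>z\<in>ball x r. Jf z). conorm T)"

definition blinfun_isomorphism :: "('a::real_normed_vector \<Rightarrow>\<^sub>L 'b::real_normed_vector) \<Rightarrow> bool" where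
  "blinfun_isomorphism T \<longleftrightarrow> bij (blinfun_apply T) \<and> bounded_linear (inv (blinfun_apply T))"

definition regular_at ::
  "('a::real_normed_vector \<Rightarrow> ('a \<Rightarrow>\<^sub>L 'b::real_normed_vector) set) \<Rightarrow> 'a set \<Rightarrow> 'a \<Rightarrow> bool" where
  "regular_at Jf U x \<longleftrightarrow>
     (\<exists>r>0. ball x r \<subseteq> U \<and> (\<forall>T\<in>convex hull (\<Union>z\<in>ball x r. Jf z). blinfun_isomorphism T)) \<and>
     regularity_index Jf U x > 0"

definition locally_Lipschitz :: "('a::metric_space \<Rightarrow> 'b::metric_space) \<Rightarrow> bool" where
  "locally_Lipschitz g \<longleftrightarrow> (\<forall>x. \<exists>r>0. \<exists>L. L-lipschitz_on (ball x r) g)"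

end

theory Submission
  imports Defs
begin

text \<open>
  Regularity at \<open>x\<close> makes \<open>f\<close> locally invertible, and the regularity index measures how well: if
  \<open>0 < \<alpha> < \<alpha>\<^bsub>Jf\<^esub>(x)\<close>, then on some ball around \<open>x\<close> the map expands distances at least
  by the factor \<open>\<alpha>\<close> and the image of every smaller ball \<open>ball u s\<close> contains \<open>ball (f u) (\<alpha> * s)\<close>
  (\<open>regular_pseudo_Jacobian_expands_openly\<close>). The expansion is a mean value theorem: by separation,
  an increment \<open>f v - f u\<close> cannot be shorter than every vector \<open>T (v - u)\<close> with \<open>T\<close> in the convex
  hull of the pseudo-Jacobians (\<open>pseudo_Jacobian_expanding\<close>). The covering of balls uses the chain rule
  condition: as long as \<open>f z \<noteq> y\<close>, the chain set at \<open>z\<close> has no element of norm less than \<open>\<alpha>\<close>, and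
  because it is weak-star closed and convex, there is one direction in which the distance from \<open>f\<close>
  to \<open>y\<close> decreases at a rate close to \<open>\<alpha>\<close> (\<open>chain_rule_steep_descent\<close>). Ekeland's principle excludes
  this at an approximate minimizer of the distance, so that the equation \<open>f z = y\<close> has a solution
  (\<open>chain_rule_open\<close>).

  Local invertibility alone does not make \<open>f\<close> globally invertible: the lift of a segment may run off
  to infinity in finite time. As the segment is compact, (b) bounds the index from below over its
  preimage; this makes lifts Lipschitz with a uniform constant, so they reach the end of the
  segment. The end points of the lifts of all segments that start at a given value of \<open>f\<close> define a
  continuous global inverse
  (\<open>locally_expanding_global_homeomorphism\<close>). This is the passage from (b) to (a). The inverse of a
  homeomorphism with the local expansion property is locally Lipschitz, which gives (c); and (a)
  implies (b) because the preimage of a compact set under a homeomorphism is compact and the index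
  is locally bounded below by positive numbers.
\<close>

section \<open>The Hahn-Banach theorem\<close>

definition sublinear :: "('a::real_vector \<Rightarrow> real) \<Rightarrow> bool" where
  "sublinear p \<longleftrightarrow> (\<forall>x y. p (x + y) \<le> p x + p y) \<and> (\<forall>x c. 0 \<le> c \<longrightarrow> p (c *\<^sub>R x) = c * p x)"

lemma sublinear_add: "sublinear p \<Longrightarrow> p (x + y) \<le> p x + p y"
  and sublinear_scale: "sublinear p \<Longrightarrow> 0 \<le> c \<Longrightarrow> p (c *\<^sub>R x) = c * p x"
  by (auto simp: sublinear_def)

lemma sublinear_zero: "sublinear p \<Longrightarrow> p 0 = 0"
  using sublinear_scale[of p 0 0] by simp

lemma sublinear_ge_minus: "sublinear p \<Longrightarrow> - p (- x) \<le> p x"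
  using sublinear_add[of p x "- x"] sublinear_zero[of p] by simp

text \<open>For the homogeneity equation one inequality is enough: applied to \<open>1 / c\<close> and
  \<open>c *\<^sub>R x\<close> it gives the other one.\<close>

lemma sublinearI:
  assumes "\<And>x y. p (x + y) \<le> p x + p y" "p 0 = 0" "\<And>x c. 0 < c \<Longrightarrow> p (c *\<^sub>R x) \<le> c * p x"
  shows "sublinear p"
  unfolding sublinear_def
proof (intro conjI allI impI)
  fix x :: 'a and c :: real
  assume "0 \<le> c"
  show "p (c *\<^sub>R x) = c * p x"
  proof (cases "c = 0")
    case False
    with \<open>0 \<le> c\<close> have c: "0 < c" by simp
    have "p ((1 / c) *\<^sub>R (c *\<^sub>R x)) \<le> (1 / c) * p (c *\<^sub>R x)"
      using c by (intro assms(3)) simp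
    then have "c * p x \<le> p (c *\<^sub>R x)"
      using c by (simp add: field_simps)
    with assms(3)[OF c, of x] show ?thesis by simp
  qed (simp add: assms(2))
qed (rule assms(1))

lemma additive_sublinear_linear:
  assumes p: "sublinear p" and add: "\<And>x y. p (x + y) = p x + p y"
  shows "linear p"
proof (rule linearI)
  fix x :: 'a and c :: real
  have neg: "p (- z) = - p z" for z
    using add[of z "- z"] sublinear_zero[OF p] by simp
  show "p (c *\<^sub>R x) = c *\<^sub>R p x"
  proof (cases "0 \<le> c")
    case True
    then show ?thesis using sublinear_scale[OF p] by simp
  next
    case False
    then have "p ((- c) *\<^sub>R x) = - c * p x"
      by (intro sublinear_scale[OF p]) simp
    then show ?thesis using neg[of "c *\<^sub>R x"] by simp
  qed
qed (rule add)

text \<open>The lower bounds that Zorn's lemma asks for. The infimum is finite because a sublinear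
  \<open>q \<le> p\<close> satisfies \<open>q x \<ge> - q (- x) \<ge> - p (- x)\<close>, and it is subadditive because two
  members of a chain can be replaced by the smaller one.\<close>

lemma sublinear_chain_Inf:
  assumes ne: "C \<noteq> {}" and sub: "\<And>q. q \<in> C \<Longrightarrow> sublinear q" and le: "\<And>q x. q \<in> C \<Longrightarrow> q x \<le> p x"
    and chain: "\<And>q r. q \<in> C \<Longrightarrow> r \<in> C \<Longrightarrow> q \<le> r \<or> r \<le> q"
  shows "sublinear (\<lambda>x. INF q\<in>C. q x)" and "q \<in> C \<Longrightarrow> (INF q\<in>C. q x) \<le> q x"
proof -
  have lower: "- p (- x) \<le> q x" if "q \<in> C" for q x
    using sublinear_ge_minus[OF sub[OF that], of x] le[OF that, of "- x"] by linarith
  have bdd: "bdd_below ((\<lambda>q. q x) ` C)" for x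
    using lower by (intro bdd_belowI2)
  show INF_le: "(INF q\<in>C. q x) \<le> q x" if "q \<in> C" for q x
    using bdd that by (rule cINF_lower)
  show "sublinear (\<lambda>x. INF q\<in>C. q x)"
  proof (rule sublinearI)
    fix x y
    have step: "(INF q\<in>C. q (x + y)) \<le> q x + r y" if "q \<in> C" "r \<in> C" for q r
    proof -
      obtain s where s: "s \<in> C" "s \<le> q" "s \<le> r"
        using chain[OF \<open>q \<in> C\<close> \<open>r \<in> C\<close>] \<open>q \<in> C\<close> \<open>r \<in> C\<close> by (meson order_refl)
      have "(INF q\<in>C. q (x + y)) \<le> s (x + y)"
        using s by (intro INF_le)
      also have "\<dots> \<le> s x + s y"
        using sublinear_add[OF sub] s by blast
      also have "\<dots> \<le> q x + r y"
        using s by (simp add: le_fun_def add_mono)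
      finally show ?thesis .
    qed
    have half: "(INF q\<in>C. q (x + y)) - q x \<le> (INF r\<in>C. r y)" if q: "q \<in> C" for q
    proof (rule cINF_greatest[OF ne])
      show "(INF q\<in>C. q (x + y)) - q x \<le> r y" if "r \<in> C" for r
        using step[OF q that] by linarith
    qed
    have "(INF q\<in>C. q (x + y)) - (INF r\<in>C. r y) \<le> (INF q\<in>C. q x)"
    proof (rule cINF_greatest[OF ne])
      show "(INF q\<in>C. q (x + y)) - (INF r\<in>C. r y) \<le> q x" if "q \<in> C" for q
        using half[OF that] by linarith
    qed
    then show "(INF q\<in>C. q (x + y)) \<le> (INF q\<in>C. q x) + (INF q\<in>C. q y)"
      by simp
  next
    have "(INF q\<in>C. q 0) = (INF q\<in>C. (0::real))"
      by (intro INF_cong) (auto simp: sublinear_zero sub)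
    then show "(INF q\<in>C. q 0) = 0"
      using ne by simp
  next
    fix x and c :: real
    assume c: "0 < c"
    have "(INF q\<in>C. q (c *\<^sub>R x)) / c \<le> (INF q\<in>C. q x)"
    proof (rule cINF_greatest[OF ne])
      fix q assume q: "q \<in> C"
      have "(INF q\<in>C. q (c *\<^sub>R x)) \<le> c * q x"
        using INF_le[OF q] sublinear_scale[OF sub[OF q]] c by (metis less_imp_le)
      then show "(INF q\<in>C. q (c *\<^sub>R x)) / c \<le> q x"
        using c by (simp add: field_simps)
    qed
    then show "(INF q\<in>C. q (c *\<^sub>R x)) \<le> c * (INF q\<in>C. q x)"
      using c by (simp add: field_simps)
  qed
qed

lemma exists_minimal_sublinear:
  fixes p :: "'a::real_vector \<Rightarrow> real"
  assumes p: "sublinear p"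
  obtains m where "sublinear m" "m \<le> p" "\<And>q. sublinear q \<Longrightarrow> q \<le> m \<Longrightarrow> q = m"
proof -
  define A where "A = {q :: 'a \<Rightarrow> real. sublinear q \<and> q \<le> p}"
  have "\<exists>m\<in>A. \<forall>a\<in>A. a \<le> m \<longrightarrow> a = m"
  proof (rule predicate_Zorn)
    show "partial_order_on A (relation_of (\<lambda>x y. y \<le> x) A)"
      by (auto simp: partial_order_on_relation_ofI)
  next
    fix C
    assume C: "C \<in> Chains (relation_of (\<lambda>x y. y \<le> x) A)"
    then have CA: "C \<subseteq> A" and chain: "\<And>q r. q \<in> C \<Longrightarrow> r \<in> C \<Longrightarrow> q \<le> r \<or> r \<le> q"
      unfolding Chains_def relation_of_def by blast+
    show "\<exists>u\<in>A. \<forall>a\<in>C. u \<le> a"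
    proof (cases "C = {}")
      case True
      with p show ?thesis by (auto simp: A_def)
    next
      case False
      define u where "u = (\<lambda>x. INF q\<in>C. q x)"
      have sub: "\<And>q. q \<in> C \<Longrightarrow> sublinear q" and le: "\<And>q x. q \<in> C \<Longrightarrow> q x \<le> p x"
        using CA by (auto simp: A_def le_fun_def)
      have u: "sublinear u" "\<And>q x. q \<in> C \<Longrightarrow> u x \<le> q x"
        unfolding u_def using sublinear_chain_Inf[of C p] False sub le chain by auto
      moreover have "u \<le> p"
        using False u(2) le by (meson equals0I le_funI order_trans)
      ultimately show ?thesis
        by (auto simp: A_def le_fun_def intro!: bexI[of _ u])
    qed
  qed
  then show ?thesis
    using that by (fastforce simp: A_def)
qed

text \<open>Minimality is tested on \<open>q z = inf\<^bsub>t \<ge> 0\<^esub> (m (z + t y) - t m y)\<close>, the sublinear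
  functional below \<open>m\<close> obtained by forcing linearity in the direction \<open>y\<close>. Since \<open>q = m\<close>,
  the value \<open>t = 1\<close> yields \<open>m x + m y \<le> m (x + y)\<close>, so \<open>m\<close> is additive.\<close>

lemma minimal_sublinear_linear:
  fixes m :: "'a::real_vector \<Rightarrow> real"
  assumes m: "sublinear m" and min: "\<And>q. sublinear q \<Longrightarrow> q \<le> m \<Longrightarrow> q = m"
  shows "linear m"
proof (rule additive_sublinear_linear[OF m])
  fix x y
  define q where "q z = (INF t\<in>{0..}. m (z + t *\<^sub>R y) - t * m y)" for z
  have lower: "- m (- z) \<le> m (z + t *\<^sub>R y) - t * m y" if "0 \<le> t" for z t
    using sublinear_add[OF m, of "- z" "z + t *\<^sub>R y"] sublinear_scale[OF m that, of y] by simp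
  have bdd: "bdd_below ((\<lambda>t. m (z + t *\<^sub>R y) - t * m y) ` {0..})" for z
    using lower by (intro bdd_belowI2) auto
  have q_le: "q z \<le> m (z + t *\<^sub>R y) - t * m y" if "0 \<le> t" for z t
    unfolding q_def using bdd that by (intro cINF_lower) auto
  have q_ge: "b \<le> q z" if "\<And>t. 0 \<le> t \<Longrightarrow> b \<le> m (z + t *\<^sub>R y) - t * m y" for b z
    unfolding q_def using that by (intro cINF_greatest) auto
  have "sublinear q"
  proof (rule sublinearI)
    fix z w
    have step: "q (z + w) \<le> (m (z + s *\<^sub>R y) - s * m y) + (m (w + t *\<^sub>R y) - t * m y)"
      if "0 \<le> s" "0 \<le> t" for s t
    proof -
      have "q (z + w) \<le> m ((z + w) + (s + t) *\<^sub>R y) - (s + t) * m y"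
        using that by (intro q_le) simp
      also have "(z + w) + (s + t) *\<^sub>R y = (z + s *\<^sub>R y) + (w + t *\<^sub>R y)"
        by (simp add: algebra_simps)
      finally show ?thesis
        using sublinear_add[OF m, of "z + s *\<^sub>R y" "w + t *\<^sub>R y"] by (simp add: algebra_simps)
    qed
    have half: "q (z + w) - (m (z + s *\<^sub>R y) - s * m y) \<le> q w" if s: "0 \<le> s" for s
    proof (rule q_ge)
      show "q (z + w) - (m (z + s *\<^sub>R y) - s * m y) \<le> m (w + t *\<^sub>R y) - t * m y" if "0 \<le> t" for t
        using step[OF s that] by linarith
    qed
    have "q (z + w) - q w \<le> q z"
    proof (rule q_ge)
      show "q (z + w) - q w \<le> m (z + s *\<^sub>R y) - s * m y" if "0 \<le> s" for s
        using half[OF that] by linarith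
    qed
    then show "q (z + w) \<le> q z + q w" by simp
  next
    have "q 0 \<le> 0"
      using q_le[of 0 0] sublinear_zero[OF m] by simp
    moreover have "0 \<le> q 0"
      by (rule q_ge) (simp add: sublinear_scale[OF m])
    ultimately show "q 0 = 0" by simp
  next
    fix z and c :: real
    assume c: "0 < c"
    have "q (c *\<^sub>R z) / c \<le> q z"
    proof (rule q_ge)
      fix t :: real assume t: "0 \<le> t"
      have "q (c *\<^sub>R z) \<le> m (c *\<^sub>R z + (c * t) *\<^sub>R y) - c * t * m y"
        using t c by (intro q_le) simp
      also have "c *\<^sub>R z + (c * t) *\<^sub>R y = c *\<^sub>R (z + t *\<^sub>R y)"
        by (simp add: algebra_simps)
      also have "m \<dots> = c * m (z + t *\<^sub>R y)"
        using c by (intro sublinear_scale[OF m]) simp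
      finally show "q (c *\<^sub>R z) / c \<le> m (z + t *\<^sub>R y) - t * m y"
        using c by (simp add: field_simps)
    qed
    then show "q (c *\<^sub>R z) \<le> c * q z"
      using c by (simp add: field_simps)
  qed
  moreover have "q \<le> m"
    using q_le[of 0] by (simp add: le_fun_def)
  ultimately have "q = m" by (rule min)
  then have "m x \<le> m (x + y) - m y"
    using q_le[of 1 x] by simp
  then show "m (x + y) = m x + m y"
    using sublinear_add[OF m, of x y] by simp
qed

theorem Hahn_Banach_sublinear:
  fixes p :: "'a::real_vector \<Rightarrow> real"
  assumes "sublinear p"
  obtains g where "linear g" "\<And>x. g x \<le> p x"
  using exists_minimal_sublinear[OF assms] minimal_sublinear_linear by (metis le_funD)

text \<open>A convex cone \<open>K\<close> of constraints \<open>g u \<le> a\<close> can be met by a linear \<open>g\<close> below \<open>N\<close> as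
  soon as no single constraint contradicts \<open>g u \<ge> - N (- u)\<close>. All the constraints are absorbed
  into one sublinear functional, the infimal convolution \<open>p\<close> of \<open>N\<close> with \<open>K\<close>, to which the
  Hahn-Banach theorem applies.\<close>

lemma sandwich_cone:
  fixes N :: "'a::real_vector \<Rightarrow> real" and K :: "('a \<times> real) set"
  assumes N: "sublinear N"
    and K0: "(0, 0) \<in> K"
    and Kadd: "\<And>u a v b. (u, a) \<in> K \<Longrightarrow> (v, b) \<in> K \<Longrightarrow> (u + v, a + b) \<in> K"
    and Kscale: "\<And>u a c. (u, a) \<in> K \<Longrightarrow> 0 < c \<Longrightarrow> (c *\<^sub>R u, c * a) \<in> K"
    and above: "\<And>u a. (u, a) \<in> K \<Longrightarrow> - N (- u) \<le> a"
  obtains g where "linear g" "\<And>x. g x \<le> N x" "\<And>u a. (u, a) \<in> K \<Longrightarrow> g u \<le> a"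
proof -
  define p where "p x = (INF (u, a)\<in>K. a + N (x - u))" for x
  have lower: "- N (- x) \<le> a + N (x - u)" if "(u, a) \<in> K" for u a x
    using above[OF that] sublinear_add[OF N, of "x - u" "- x"] by simp
  have bdd: "bdd_below ((\<lambda>(u, a). a + N (x - u)) ` K)" for x
    using lower by (intro bdd_belowI2[where m = "- N (- x)"]) auto
  have p_le: "p x \<le> a + N (x - u)" if "(u, a) \<in> K" for x u a
    unfolding p_def using cINF_lower[OF bdd that] by simp
  have p_ge: "b \<le> p x" if "\<And>u a. (u, a) \<in> K \<Longrightarrow> b \<le> a + N (x - u)" for b x
    unfolding p_def using that K0 by (intro cINF_greatest) auto
  have "sublinear p"
  proof (rule sublinearI)
    fix x y
    have step: "p (x + y) \<le> (a + N (x - u)) + (b + N (y - v))" if "(u, a) \<in> K" "(v, b) \<in> K" for u a v b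
      using p_le[OF Kadd[OF that], of "x + y"] sublinear_add[OF N, of "x - u" "y - v"]
      by (simp add: algebra_simps)
    have half: "p (x + y) - (a + N (x - u)) \<le> p y" if ua: "(u, a) \<in> K" for u a
    proof (rule p_ge)
      show "p (x + y) - (a + N (x - u)) \<le> b + N (y - v)" if "(v, b) \<in> K" for v b
        using step[OF ua that] by linarith
    qed
    have "p (x + y) - p y \<le> p x"
    proof (rule p_ge)
      show "p (x + y) - p y \<le> a + N (x - u)" if "(u, a) \<in> K" for u a
        using half[OF that] by linarith
    qed
    then show "p (x + y) \<le> p x + p y" by simp
  next
    have "p 0 \<le> 0"
      using p_le[OF K0, of 0] sublinear_zero[OF N] by simp
    moreover have "0 \<le> p 0"
      using above by (intro p_ge) fastforce
    ultimately show "p 0 = 0" by simp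
  next
    fix x and c :: real
    assume c: "0 < c"
    have "p (c *\<^sub>R x) / c \<le> p x"
    proof (rule p_ge)
      fix u a assume ua: "(u, a) \<in> K"
      have "p (c *\<^sub>R x) \<le> c * a + N (c *\<^sub>R (x - u))"
        using p_le[OF Kscale[OF ua c], of "c *\<^sub>R x"] by (simp add: algebra_simps)
      also have "N (c *\<^sub>R (x - u)) = c * N (x - u)"
        using c by (intro sublinear_scale[OF N]) simp
      finally show "p (c *\<^sub>R x) / c \<le> a + N (x - u)"
        using c by (simp add: field_simps)
    qed
    then show "p (c *\<^sub>R x) \<le> c * p x"
      using c by (simp add: field_simps)
  qed
  then obtain g where g: "linear g" "\<And>x. g x \<le> p x"
    by (rule Hahn_Banach_sublinear) blast
  show ?thesis
  proof
    show "g x \<le> N x" for x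
      using g(2)[of x] p_le[OF K0, of x] by simp
    show "g u \<le> a" if "(u, a) \<in> K" for u a
      using g(2)[of u] p_le[OF that, of u] sublinear_zero[OF N] by simp
  qed (rule g(1))
qed

text \<open>Separation of \<open>C\<close> from the open \<open>N\<close>-ball of radius \<open>\<beta>\<close>, quantitatively. The requirement
  \<open>g c \<ge> \<beta>\<close> is the constraint \<open>g (- c) \<le> - \<beta>\<close>, and the multiples of these constraints form a
  convex cone because \<open>C\<close> is convex. A seminorm instead of a norm allows the use for the
  weak-star topology below.\<close>

lemma separation_from_seminorm_ball:
  fixes N :: "'a::real_vector \<Rightarrow> real"
  assumes N: "sublinear N" and sym: "\<And>x. N (- x) = N x" and C: "convex C" "C \<noteq> {}"
    and far: "\<And>c. c \<in> C \<Longrightarrow> \<beta> \<le> N c"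
  obtains g where "linear g" "\<And>x. g x \<le> N x" "\<And>c. c \<in> C \<Longrightarrow> \<beta> \<le> g c"
proof -
  define K where "K = {(- (t *\<^sub>R c), - (t * \<beta>)) | t c. 0 \<le> t \<and> c \<in> C}"
  have KI: "(- (t *\<^sub>R c), - (t * \<beta>)) \<in> K" if "0 \<le> t" "c \<in> C" for t c
    using that by (auto simp: K_def)
  obtain c0 where c0: "c0 \<in> C" using C(2) by blast
  obtain g where g: "linear g" "\<And>x. g x \<le> N x" "\<And>u a. (u, a) \<in> K \<Longrightarrow> g u \<le> a"
  proof (rule sandwich_cone[OF N, of K])
    show "(0, 0) \<in> K"
      using KI[of 0 c0] c0 by simp
  next
    fix u a v b
    assume "(u, a) \<in> K" "(v, b) \<in> K"
    then obtain s c t d where s: "0 \<le> s" "c \<in> C" "u = - (s *\<^sub>R c)" "a = - (s * \<beta>)"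
      and t: "0 \<le> t" "d \<in> C" "v = - (t *\<^sub>R d)" "b = - (t * \<beta>)"
      by (auto simp: K_def)
    show "(u + v, a + b) \<in> K"
    proof (cases "s + t = 0")
      case True
      then have "s = 0" "t = 0" using s t by auto
      then show ?thesis using KI[of 0 c0] c0 s t by simp
    next
      case False
      then have pos: "0 < s + t" using s t by linarith
      define e where "e = (s / (s + t)) *\<^sub>R c + (t / (s + t)) *\<^sub>R d"
      have "e \<in> C"
        unfolding e_def using s t pos
        by (intro convexD[OF C(1)]) (auto simp: add_divide_distrib[symmetric])
      moreover have "(s + t) *\<^sub>R e = s *\<^sub>R c + t *\<^sub>R d"
        using pos by (simp add: e_def scaleR_add_right)
      ultimately show ?thesis
        using KI[of "s + t" e] s t pos by (simp add: algebra_simps)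
    qed
  next
    fix u a and k :: real
    assume "(u, a) \<in> K" and k: "0 < k"
    then obtain t c where t: "0 \<le> t" "c \<in> C" "u = - (t *\<^sub>R c)" "a = - (t * \<beta>)"
      by (auto simp: K_def)
    then show "(k *\<^sub>R u, k * a) \<in> K"
      using KI[of "k * t" c] k by (simp add: mult.assoc)
  next
    fix u a
    assume "(u, a) \<in> K"
    then obtain t c where t: "0 \<le> t" "c \<in> C" "u = - (t *\<^sub>R c)" "a = - (t * \<beta>)"
      by (auto simp: K_def)
    have "t * \<beta> \<le> t * N c"
      using far t by (intro mult_left_mono) auto
    also have "\<dots> = N (- u)"
      using sublinear_scale[OF N t(1)] t by simp
    finally show "- N (- u) \<le> a" using t by simp
  qed blast
  show ?thesis
  proof
    show "\<beta> \<le> g c" if "c \<in> C" for c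
      using g(3)[OF KI[of 1 c]] that by (simp add: linear_neg[OF g(1)])
  qed (use g in auto)
qed

lemma linear_le_norm_bounded_linear:
  fixes g :: "'a::real_normed_vector \<Rightarrow> real"
  assumes g: "linear g" and le: "\<And>x. g x \<le> B * norm x"
  shows "bounded_linear g"
proof -
  have "\<bar>g x\<bar> \<le> norm x * B" for x
    using le[of x] le[of "- x"] by (simp add: linear_neg[OF g] abs_le_iff mult.commute)
  with g show ?thesis
    by (auto simp: bounded_linear_def bounded_linear_axioms_def)
qed

section \<open>Weak-star closed convex sets of functionals\<close>

text \<open>The functionals are eliminated one at a time: subtracting from \<open>G\<close> the multiple of \<open>\<phi> j\<close> that
  agrees with it at a vector \<open>b\<close> of the remaining kernel reduces the claim to fewer functionals.\<close>

lemma linear_vanishing_on_common_kernel: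
  fixes \<phi> :: "'i \<Rightarrow> 'a::real_vector \<Rightarrow> real"
  assumes "finite F" and "\<And>i. i \<in> F \<Longrightarrow> linear (\<phi> i)" and "linear G"
    and "\<And>a. (\<forall>i\<in>F. \<phi> i a = 0) \<Longrightarrow> G a = 0"
  shows "\<exists>l. \<forall>a. G a = (\<Sum>i\<in>F. l i * \<phi> i a)"
  using assms
proof (induction F arbitrary: G rule: finite_induct)
  case empty
  then show ?case by simp
next
  case (insert j F)
  show ?case
  proof (cases "\<forall>a. (\<forall>i\<in>F. \<phi> i a = 0) \<longrightarrow> \<phi> j a = 0")
    case True
    then obtain l where l: "\<forall>a. G a = (\<Sum>i\<in>F. l i * \<phi> i a)"
      using insert.IH[of G] insert.prems by auto
    have "(\<Sum>i\<in>F. (l(j := 0)) i * \<phi> i a) = (\<Sum>i\<in>F. l i * \<phi> i a)" for a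
      using insert.hyps by (intro sum.cong) auto
    then show ?thesis
      using l insert.hyps by (intro exI[of _ "l(j := 0)"]) simp
  next
    case False
    then obtain b where b: "\<forall>i\<in>F. \<phi> i b = 0" "\<phi> j b \<noteq> 0" by blast
    define c where "c = G b / \<phi> j b"
    have linj: "linear (\<phi> j)" using insert.prems by simp
    have "\<exists>l. \<forall>a. G a - c * \<phi> j a = (\<Sum>i\<in>F. l i * \<phi> i a)"
    proof (rule insert.IH)
      show "linear (\<lambda>a. G a - c * \<phi> j a)"
        using insert.prems(2) linj
        by (auto intro!: linearI simp: linear_add linear_scale algebra_simps)
      fix a assume a: "\<forall>i\<in>F. \<phi> i a = 0"
      have "G (a - (\<phi> j a / \<phi> j b) *\<^sub>R b) = 0"
      proof (rule insert.prems(3), rule ballI)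
        fix i assume i: "i \<in> insert j F"
        then have "linear (\<phi> i)" by (rule insert.prems(1))
        then show "\<phi> i (a - (\<phi> j a / \<phi> j b) *\<^sub>R b) = 0"
          using i a b by (auto simp: linear_diff linear_scale)
      qed
      then show "G a - c * \<phi> j a = 0"
        using insert.prems(2) by (simp add: linear_diff linear_scale c_def)
    qed (use insert.prems in auto)
    then obtain l where l: "\<forall>a. G a - c * \<phi> j a = (\<Sum>i\<in>F. l i * \<phi> i a)" by blast
    have "(\<Sum>i\<in>F. (l(j := c)) i * \<phi> i a) = (\<Sum>i\<in>F. l i * \<phi> i a)" for a
      using insert.hyps by (intro sum.cong) auto
    then show ?thesis
      using l insert.hyps by (intro exI[of _ "l(j := c)"]) (simp add: algebra_simps)
  qed
qed

lemma strong_operator_open_contains_basic: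
  fixes g :: "'a::real_normed_vector \<Rightarrow>\<^sub>L 'b::real_normed_vector"
  assumes U: "openin strong_operator_topology U" and g: "g \<in> U"
  obtains F \<delta> where "finite F" "0 < \<delta>"
    "\<And>a. (\<And>v. v \<in> F \<Longrightarrow> norm (blinfun_apply a v - blinfun_apply g v) < \<delta>) \<Longrightarrow> a \<in> U"
proof -
  obtain W where W: "open W" "U = blinfun_apply -` W"
    using U unfolding strong_operator_topology_def openin_pullback_topology by auto
  have "blinfun_apply g \<in> W" using g W by simp
  then obtain X where X: "blinfun_apply g \<in> (\<Pi>\<^sub>E i\<in>UNIV. X i)" "\<And>i. open (X i)"
    "finite {i. X i \<noteq> UNIV}" "(\<Pi>\<^sub>E i\<in>UNIV. X i) \<subseteq> W"
    using product_topology_open_contains_basis[of "\<lambda>_. euclidean" UNIV W "blinfun_apply g"] W(1)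
    unfolding open_fun_def by auto
  define F where "F = {i. X i \<noteq> UNIV}"
  have "\<exists>d>0. ball (blinfun_apply g i) d \<subseteq> X i" for i
    using X(1,2) by (auto simp: open_contains_ball PiE_def)
  then obtain d where d: "\<And>i. 0 < d i" "\<And>i. ball (blinfun_apply g i) (d i) \<subseteq> X i"
    by metis
  define \<delta> where "\<delta> = Min (insert 1 (d ` F))"
  have fin: "finite F" using X(3) by (simp add: F_def)
  show ?thesis
  proof
    show "finite F" by (fact fin)
    show "0 < \<delta>" using fin d(1) by (auto simp: \<delta>_def)
    fix a :: "'a \<Rightarrow>\<^sub>L 'b"
    assume a: "\<And>v. v \<in> F \<Longrightarrow> norm (blinfun_apply a v - blinfun_apply g v) < \<delta>"
    have "blinfun_apply a i \<in> X i" for i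
    proof (cases "i \<in> F")
      case True
      then have "norm (blinfun_apply a i - blinfun_apply g i) < d i"
        using a[OF True] fin by (auto simp: \<delta>_def)
      then show ?thesis
        using d(2)[of i] by (auto simp: dist_norm norm_minus_commute)
    qed (simp add: F_def)
    then show "a \<in> U" using X(4) W(2) by auto
  qed
qed

text \<open>A weak-star closed convex set is the intersection of the half-spaces given by vectors of the
  predual. If \<open>g\<close> is outside \<open>A\<close>, some finite set \<open>F\<close> of vectors already keeps \<open>A\<close> away from \<open>g\<close>
  in the seminorm \<open>N\<close> of evaluations on \<open>F\<close>. A functional that separates with respect to \<open>N\<close>
  vanishes where the evaluations on \<open>F\<close> do, so it is itself the evaluation at a vector \<open>u\<close> of
  their span, and \<open>- u\<close> violates \<open>below\<close>.\<close>

lemma weak_star_closed_convex_support: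
  fixes A :: "('a::real_normed_vector \<Rightarrow>\<^sub>L real) set"
  assumes closed: "closedin strong_operator_topology A" and "convex A" "A \<noteq> {}"
    and below: "\<And>u m. (\<And>a. a \<in> A \<Longrightarrow> blinfun_apply a u \<le> m) \<Longrightarrow> blinfun_apply g u \<le> m"
  shows "g \<in> A"
proof (rule ccontr)
  assume "g \<notin> A"
  have "openin strong_operator_topology (- A)"
    using closed by (simp add: closedin_def strong_operator_topology_topspace Compl_eq_Diff_UNIV)
  then obtain F \<delta> where F: "finite F" and \<delta>: "0 < \<delta>"
    and nbhd: "\<And>a. (\<And>v. v \<in> F \<Longrightarrow> norm (blinfun_apply a v - blinfun_apply g v) < \<delta>) \<Longrightarrow> a \<in> - A"
    using strong_operator_open_contains_basic[of "- A" g] \<open>g \<notin> A\<close> by auto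
  define N where "N a = (\<Sum>v\<in>F. \<bar>blinfun_apply a v\<bar>)" for a :: "'a \<Rightarrow>\<^sub>L real"
  define C where "C = (\<lambda>a. a - g) ` A"
  have N: "sublinear N"
  proof (rule sublinearI)
    show "N (a + b) \<le> N a + N b" for a b
      unfolding N_def sum.distrib[symmetric] by (intro sum_mono) (simp add: blinfun.add_left)
  qed (simp_all add: N_def blinfun.scaleR_left abs_mult sum_distrib_left)
  have "convex C"
    unfolding C_def by (rule convex_translation_subtract[OF \<open>convex A\<close>])
  have far: "\<delta> \<le> N c" if c: "c \<in> C" for c
  proof -
    obtain a where a: "a \<in> A" "c = a - g" using c by (auto simp: C_def)
    then obtain v where v: "v \<in> F" "\<delta> \<le> \<bar>blinfun_apply a v - blinfun_apply g v\<bar>"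
      using nbhd[of a] by fastforce
    have "\<bar>blinfun_apply c v\<bar> \<le> N c"
      unfolding N_def using F v(1) by (intro member_le_sum) auto
    with v show ?thesis by (simp add: a blinfun.diff_left)
  qed
  obtain G where G: "linear G" "\<And>c. G c \<le> N c" "\<And>c. c \<in> C \<Longrightarrow> \<delta> \<le> G c"
  proof (rule separation_from_seminorm_ball[OF N _ \<open>convex C\<close> _ far])
    show "N (- x) = N x" for x by (simp add: N_def blinfun.minus_left)
    show "C \<noteq> {}" using \<open>A \<noteq> {}\<close> by (simp add: C_def)
  qed blast+
  have "\<exists>l. \<forall>a. G a = (\<Sum>v\<in>F. l v * blinfun_apply a v)"
  proof (rule linear_vanishing_on_common_kernel[OF F _ G(1)])
    show "linear (\<lambda>a. blinfun_apply a v)" for v :: 'a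
      by (auto intro!: linearI simp: blinfun.add_left blinfun.scaleR_left)
    fix a :: "'a \<Rightarrow>\<^sub>L real"
    assume "\<forall>v\<in>F. blinfun_apply a v = 0"
    then have "N a = 0" "N (- a) = 0" by (auto simp: N_def blinfun.minus_left)
    then show "G a = 0"
      using G(2)[of a] G(2)[of "- a"] by (simp add: linear_neg[OF G(1)])
  qed
  then obtain l where l: "\<And>a. G a = (\<Sum>v\<in>F. l v * blinfun_apply a v)" by blast
  define u where "u = (\<Sum>v\<in>F. l v *\<^sub>R v)"
  have Gu: "G a = blinfun_apply a u" for a
    by (simp add: l u_def blinfun.sum_right blinfun.scaleR_right)
  have "blinfun_apply a (- u) \<le> blinfun_apply g (- u) - \<delta>" if "a \<in> A" for a
    using G(3)[of "a - g"] that
    by (auto simp: Gu C_def blinfun.minus_right blinfun.diff_left)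
  then have "blinfun_apply g (- u) \<le> blinfun_apply g (- u) - \<delta>"
    by (rule below)
  with \<delta> show False by simp
qed

text \<open>This plays the part of the minimax argument with the weak-star compact ball of radius \<open>\<epsilon>\<close>.
  The hypothesis says that the support function of \<open>A\<close> stays above \<open>- \<epsilon> * norm u\<close>; the sandwich
  lemma puts a functional \<open>g\<close> of norm at most \<open>\<epsilon>\<close> below that support function, and \<open>g\<close> belongs to
  \<open>A\<close> by the previous lemma.\<close>

lemma weak_star_small_element:
  fixes A :: "('a::real_normed_vector \<Rightarrow>\<^sub>L real) set"
  assumes closed: "closedin strong_operator_topology A" and "convex A" "A \<noteq> {}" and "0 \<le> \<epsilon>"
    and supp: "\<And>u m. (\<And>a. a \<in> A \<Longrightarrow> blinfun_apply a u \<le> m) \<Longrightarrow> - \<epsilon> * norm u \<le> m"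
  obtains a where "a \<in> A" "\<And>u. blinfun_apply a u \<le> \<epsilon> * norm u"
proof -
  define N where "N u = \<epsilon> * norm u" for u :: 'a
  define K where "K = {(u, m). \<forall>a\<in>A. blinfun_apply a u \<le> m}"
  have N: "sublinear N"
    unfolding N_def using \<open>0 \<le> \<epsilon>\<close>
    by (intro sublinearI)
       (auto simp: distrib_left[symmetric] intro!: mult_left_mono norm_triangle_ineq)
  obtain g where g: "linear g" "\<And>x. g x \<le> N x" "\<And>u m. (u, m) \<in> K \<Longrightarrow> g u \<le> m"
  proof (rule sandwich_cone[OF N, of K])
    show "(u + v, a + b) \<in> K" if "(u, a) \<in> K" "(v, b) \<in> K" for u a v b
      using that by (auto simp: K_def blinfun.add_right intro: add_mono)
    show "(c *\<^sub>R u, c * m) \<in> K" if "(u, m) \<in> K" "0 < c" for u m c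
      using that by (auto simp: K_def blinfun.scaleR_right)
    show "- N (- u) \<le> m" if "(u, m) \<in> K" for u m
      using supp[of u m] that by (simp add: K_def N_def)
  qed (auto simp: K_def)
  have "bounded_linear g"
    using linear_le_norm_bounded_linear[OF g(1), of \<epsilon>] g(2) by (simp add: N_def)
  then have ap: "blinfun_apply (Blinfun g) = g"
    by (rule bounded_linear_Blinfun_apply)
  show ?thesis
  proof
    show "Blinfun g \<in> A"
      using g(3) by (intro weak_star_closed_convex_support[OF closed \<open>convex A\<close> \<open>A \<noteq> {}\<close>])
        (auto simp: ap K_def)
    show "blinfun_apply (Blinfun g) u \<le> \<epsilon> * norm u" for u
      using g(2) by (simp add: ap N_def)
  qed
qed

lemma separation_from_ball:
  fixes C :: "'a::real_normed_vector set"
  assumes "convex C" "C \<noteq> {}" "\<And>c. c \<in> C \<Longrightarrow> \<beta> \<le> norm c"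
  obtains y :: "'a \<Rightarrow>\<^sub>L real" where "\<And>x. blinfun_apply y x \<le> norm x"
    "\<And>c. c \<in> C \<Longrightarrow> \<beta> \<le> blinfun_apply y c"
proof -
  have "sublinear (norm :: 'a \<Rightarrow> real)"
    by (intro sublinearI) (auto intro: norm_triangle_ineq)
  then obtain g where g: "linear g" "\<And>x. g x \<le> norm (x::'a)" "\<And>c. c \<in> C \<Longrightarrow> \<beta> \<le> g c"
    by (rule separation_from_seminorm_ball[where N = norm, OF _ norm_minus_cancel assms]) blast+
  then have "bounded_linear g"
    using linear_le_norm_bounded_linear[of g 1] by simp
  then have "blinfun_apply (Blinfun g) = g"
    by (rule bounded_linear_Blinfun_apply)
  with g show ?thesis by (intro that[of "Blinfun g"]) auto
qed

section \<open>Ekeland's principle and a mean value inequality\<close>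

text \<open>\<open>S x\<close> consists of the points that improve on \<open>x\<close> at the rate \<open>\<epsilon>\<close>. Passing again and again to
  a nearly best improvement gives a sequence along which \<open>\<phi>\<close> converges, hence a Cauchy sequence,
  since distances are controlled by decreases of \<open>\<phi>\<close>. Its limit improves on every term, so it
  cannot be improved by any point that is strictly lower.\<close>

theorem Ekeland_variational_principle:
  fixes \<phi> :: "'a::metric_space \<Rightarrow> real"
  assumes D: "complete D" and cont: "continuous_on D \<phi>" and nonneg: "\<And>x. x \<in> D \<Longrightarrow> 0 \<le> \<phi> x"
    and x0: "x0 \<in> D" and \<epsilon>: "0 < \<epsilon>"
  obtains z where "z \<in> D" "\<epsilon> * dist x0 z \<le> \<phi> x0 - \<phi> z"
    "\<And>x. x \<in> D \<Longrightarrow> \<phi> z - \<epsilon> * dist z x \<le> \<phi> x"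
proof -
  define S where "S x = {z \<in> D. \<epsilon> * dist x z \<le> \<phi> x - \<phi> z}" for x
  have S_trans: "z \<in> S x" if "y \<in> S x" "z \<in> S y" for x y z
  proof -
    have "\<epsilon> * dist x z \<le> \<epsilon> * dist x y + \<epsilon> * dist y z"
      using \<epsilon> by (simp add: distrib_left[symmetric] dist_triangle)
    then show ?thesis using that by (auto simp: S_def)
  qed
  have S_refl: "x \<in> S x" if "x \<in> D" for x
    using that by (simp add: S_def)
  have "\<exists>z\<in>S x. \<forall>w\<in>S x. \<phi> z \<le> \<phi> w + (1/2) ^ n" if x: "x \<in> D" for x and n :: nat
  proof -
    have bdd: "bdd_below (\<phi> ` S x)"
      using nonneg by (intro bdd_belowI2[where m = 0]) (auto simp: S_def)
    have "(INF w\<in>S x. \<phi> w) < (INF w\<in>S x. \<phi> w) + (1/2) ^ n" by simp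
    then obtain z where "z \<in> S x" "\<phi> z < (INF w\<in>S x. \<phi> w) + (1/2) ^ n"
      using cINF_less_iff[OF _ bdd] S_refl[OF x] by blast
    then show ?thesis
      using cINF_lower[OF bdd] by (intro bexI[of _ z]) force+
  qed
  then obtain pick where pick: "\<And>x n. x \<in> D \<Longrightarrow> pick x n \<in> S x"
    "\<And>x n w. x \<in> D \<Longrightarrow> w \<in> S x \<Longrightarrow> \<phi> (pick x n) \<le> \<phi> w + (1/2) ^ n"
    by metis
  define X where "X = rec_nat x0 (\<lambda>n x. pick x n)"
  have X0: "X 0 = x0" and XS: "X (Suc n) = pick (X n) n" for n
    by (simp_all add: X_def)
  have XD: "X n \<in> D" for n
  proof (induction n)
    case (Suc n)
    then show ?case using pick(1)[OF Suc, of n] by (simp add: XS S_def)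
  qed (simp add: X0 x0)
  have X_mono: "X n \<in> S (X m)" if "m \<le> n" for m n
    using that
  proof (induction n rule: dec_induct)
    case (step n)
    then show ?case using S_trans[OF _ pick(1)[OF XD, of n n]] by (simp add: XS)
  qed (rule S_refl[OF XD])
  have dist_le: "\<epsilon> * dist (X m) (X n) \<le> \<phi> (X m) - \<phi> (X n)" if "m \<le> n" for m n
    using X_mono[OF that] by (simp add: S_def)
  have "decseq (\<lambda>n. \<phi> (X n))"
  proof (rule decseq_SucI)
    fix n
    have "0 \<le> \<epsilon> * dist (X n) (X (Suc n))" using \<epsilon> by simp
    also have "\<dots> \<le> \<phi> (X n) - \<phi> (X (Suc n))" by (rule dist_le) simp
    finally show "\<phi> (X (Suc n)) \<le> \<phi> (X n)" by simp
  qed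
  then have "Cauchy (\<lambda>n. \<phi> (X n))"
    using decseq_convergent[of "\<lambda>n. \<phi> (X n)" 0] nonneg[OF XD] LIMSEQ_imp_Cauchy by metis
  have "Cauchy X"
  proof (rule metric_CauchyI)
    fix e :: real assume "0 < e"
    then obtain M where M: "\<And>m n. M \<le> m \<Longrightarrow> M \<le> n \<Longrightarrow> dist (\<phi> (X m)) (\<phi> (X n)) < \<epsilon> * e"
      using metric_CauchyD[OF \<open>Cauchy (\<lambda>n. \<phi> (X n))\<close>, of "\<epsilon> * e"] \<epsilon> by auto
    have "dist (X m) (X n) < e" if "M \<le> m" "M \<le> n" for m n
    proof -
      have "\<epsilon> * dist (X m) (X n) \<le> dist (\<phi> (X m)) (\<phi> (X n))"
        using dist_le[of m n] dist_le[of n m] by (cases "m \<le> n") (auto simp: dist_real_def dist_commute)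
      also have "\<dots> < \<epsilon> * e" using M that by blast
      finally show ?thesis using \<epsilon> by simp
    qed
    then show "\<exists>M. \<forall>m\<ge>M. \<forall>n\<ge>M. dist (X m) (X n) < e" by blast
  qed
  then obtain z where z: "z \<in> D" "X \<longlonglongrightarrow> z"
    using D XD by (auto simp: complete_def)
  have \<phi>z: "(\<lambda>n. \<phi> (X n)) \<longlonglongrightarrow> \<phi> z"
    using cont z XD by (auto simp: continuous_on_sequentially o_def)
  have zS: "z \<in> S (X m)" for m
  proof -
    have "\<epsilon> * dist (X m) z \<le> \<phi> (X m) - \<phi> z"
    proof (rule LIMSEQ_le)
      show "(\<lambda>n. \<epsilon> * dist (X m) (X n)) \<longlonglongrightarrow> \<epsilon> * dist (X m) z"
        by (intro tendsto_intros z)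
      show "(\<lambda>n. \<phi> (X m) - \<phi> (X n)) \<longlonglongrightarrow> \<phi> (X m) - \<phi> z"
        by (intro tendsto_intros \<phi>z)
    qed (use dist_le in blast)
    with z show ?thesis by (simp add: S_def)
  qed
  have "\<phi> z - \<epsilon> * dist z x \<le> \<phi> x" if x: "x \<in> D" for x
  proof (rule ccontr)
    assume less: "\<not> ?thesis"
    then have xS: "x \<in> S z" using x by (simp add: S_def)
    have "\<phi> z \<le> \<phi> x"
    proof (rule LIMSEQ_le)
      show "(\<lambda>n. \<phi> (X (Suc n))) \<longlonglongrightarrow> \<phi> z" by (rule LIMSEQ_Suc[OF \<phi>z])
      have "(\<lambda>n. \<phi> x + (1/2) ^ n) \<longlonglongrightarrow> \<phi> x + 0"
        by (intro tendsto_intros LIMSEQ_power_zero) simp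
      then show "(\<lambda>n. \<phi> x + (1/2) ^ n) \<longlonglongrightarrow> \<phi> x" by simp
      show "\<exists>N. \<forall>n\<ge>N. \<phi> (X (Suc n)) \<le> \<phi> x + (1/2) ^ n"
        using pick(2)[OF XD S_trans[OF zS xS]] by (auto simp: XS)
    qed
    moreover have "0 \<le> \<epsilon> * dist z x" using \<epsilon> by simp
    ultimately show False using less by linarith
  qed
  moreover have "\<epsilon> * dist x0 z \<le> \<phi> x0 - \<phi> z"
    using zS[of 0] by (simp add: S_def X0)
  ultimately show ?thesis using that z by blast
qed

text \<open>The last time \<open>c\<close> at which the line of slope \<open>M + e\<close> is not exceeded must be \<open>1\<close>: at an earlier
  \<open>c\<close> the bound on the upper derivative would let the estimate continue a little further.\<close>

lemma Dini_mean_value_inequality: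
  fixes \<psi> :: "real \<Rightarrow> real"
  assumes cont: "continuous_on {0..1} \<psi>"
    and Dini: "\<And>t. 0 \<le> t \<Longrightarrow> t < 1 \<Longrightarrow>
      Limsup (at_right 0) (\<lambda>h. ereal ((\<psi> (t + h) - \<psi> t) / h)) \<le> ereal M"
  shows "\<psi> 1 - \<psi> 0 \<le> M"
proof (rule field_le_epsilon)
  fix e :: real assume e: "0 < e"
  define A where "A = {t \<in> {0..1}. \<psi> t - \<psi> 0 - (M + e) * t \<le> 0}"
  have "closed A"
    unfolding A_def by (intro continuous_on_closed_Collect_le continuous_intros cont)
  moreover have "{0..1} \<inter> A = A" by (auto simp: A_def)
  ultimately have "compact A"
    using compact_Int_closed[OF compact_Icc[of 0 "1::real"]] by metis
  moreover have "0 \<in> A" by (simp add: A_def)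
  ultimately obtain c where c: "c \<in> A" and max: "\<And>t. t \<in> A \<Longrightarrow> t \<le> c"
    using compact_attains_sup[of A] by blast
  have "c = 1"
  proof (rule ccontr)
    assume "c \<noteq> 1"
    with c have c01: "0 \<le> c" "c < 1" by (auto simp: A_def)
    have "Limsup (at_right 0) (\<lambda>h. ereal ((\<psi> (c + h) - \<psi> c) / h)) < ereal (M + e)"
      using Dini[OF c01] e by (simp add: order.strict_trans1)
    then have "\<forall>\<^sub>F h in at_right 0. ereal ((\<psi> (c + h) - \<psi> c) / h) < ereal (M + e)"
      by (rule Limsup_lessD)
    moreover have "\<forall>\<^sub>F h in at_right 0. h \<in> {0<..<1 - c}"
      using c01 by (intro eventually_at_right_real) simp
    ultimately have "\<forall>\<^sub>F h in at_right 0. (\<psi> (c + h) - \<psi> c) / h < M + e \<and> h \<in> {0<..<1 - c}"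
      by eventually_elim simp
    then obtain h where h: "(\<psi> (c + h) - \<psi> c) / h < M + e" "0 < h" "h < 1 - c"
      using eventually_happens'[OF trivial_limit_at_right_real] by fastforce
    then have "\<psi> (c + h) - \<psi> c \<le> (M + e) * h" by (simp add: field_simps)
    then have "c + h \<in> A"
      using c h c01 by (auto simp: A_def algebra_simps)
    then show False using max[of "c + h"] h by simp
  qed
  with c show "\<psi> 1 - \<psi> 0 \<le> M + e" by (simp add: A_def)
qed

section \<open>Local inversion\<close>

text \<open>All that the global argument needs to know about \<open>f\<close> near a point: distances grow at least by
  the factor \<open>\<alpha>\<close>, and balls inside \<open>S\<close> have images that contain balls \<open>\<alpha>\<close> times as large. The first
  half makes local inverses unique and Lipschitz, the second one makes them exist.\<close>

definition expands_openly ::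
  "('a::metric_space \<Rightarrow> 'b::metric_space) \<Rightarrow> real \<Rightarrow> 'a set \<Rightarrow> bool" where
  "expands_openly f \<alpha> S \<longleftrightarrow>
     (\<forall>u\<in>S. \<forall>v\<in>S. \<alpha> * dist u v \<le> dist (f u) (f v)) \<and>
     (\<forall>u s. ball u s \<subseteq> S \<longrightarrow> ball (f u) (\<alpha> * s) \<subseteq> f ` ball u s)"

text \<open>For \<open>\<alpha> > 0\<close> the lower bound gives injectivity and a bounded inverse, so surjectivity is the
  only other thing to ask of an isomorphism.\<close>

definition coercive_isomorphisms ::
  "('a::real_normed_vector \<Rightarrow>\<^sub>L 'b::real_normed_vector) set \<Rightarrow> real \<Rightarrow> bool" where
  "coercive_isomorphisms \<T> \<alpha> \<longleftrightarrow>
     (\<forall>T\<in>\<T>. surj (blinfun_apply T) \<and> (\<forall>v. \<alpha> * norm v \<le> norm (blinfun_apply T v)))"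

lemma coercive_isomorphisms_subset:
  "coercive_isomorphisms \<T> \<alpha> \<Longrightarrow> \<S> \<subseteq> \<T> \<Longrightarrow> coercive_isomorphisms \<S> \<alpha>"
  by (auto simp: coercive_isomorphisms_def)

text \<open>Were the increment \<open>f v - f u\<close> shorter than \<open>\<alpha> * norm (v - u)\<close>, it could not be a limit of
  vectors \<open>T (v - u)\<close> with \<open>T\<close> in the convex hull, for these lie in a convex set outside the open
  ball of that radius. A functional of norm at most one that is at least \<open>\<alpha> * norm (v - u)\<close> on
  this convex set turns the claim into a scalar one: by the pseudo-Jacobian inequality along the
  segment and the mean value inequality, the same bound holds for its value on \<open>f v - f u\<close>.\<close>

lemma pseudo_Jacobian_expanding:
  fixes f :: "'a::real_normed_vector \<Rightarrow> 'b::real_normed_vector"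
  assumes cont: "continuous_on UNIV f" and pj: "pseudo_Jacobian_mapping f Jf UNIV"
    and S: "convex S" and coercive: "\<And>T w. T \<in> convex hull (\<Union>z\<in>S. Jf z) \<Longrightarrow> \<alpha> * norm w \<le> norm (blinfun_apply T w)"
    and uv: "u \<in> S" "v \<in> S"
  shows "\<alpha> * dist u v \<le> dist (f u) (f v)"
proof (rule ccontr)
  assume less: "\<not> ?thesis"
  define d where "d = v - u"
  define \<T> where "\<T> = convex hull (\<Union>z\<in>S. Jf z)"
  define C where "C = (\<lambda>T. blinfun_apply T d) ` \<T>"
  have sub: "Jf z \<subseteq> \<T>" if "z \<in> S" for z
    using that hull_subset[of "\<Union>z\<in>S. Jf z" convex] by (auto simp: \<T>_def)
  have convex: "convex C"
    unfolding C_def \<T>_def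
    by (intro convex_linear_image convex_convex_hull)
       (auto intro!: linearI simp: blinfun.add_left blinfun.scaleR_left)
  have nonempty: "C \<noteq> {}"
    using sub[OF uv(1)] pj by (auto simp: C_def pseudo_Jacobian_mapping_def pseudo_Jacobian_def)
  have far: "\<alpha> * norm d \<le> norm c" if "c \<in> C" for c
    using that coercive by (auto simp: C_def \<T>_def)
  obtain y :: "'b \<Rightarrow>\<^sub>L real" where y: "\<And>x. blinfun_apply y x \<le> norm x"
    "\<And>c. c \<in> C \<Longrightarrow> \<alpha> * norm d \<le> blinfun_apply y c"
    by (rule separation_from_ball[OF convex nonempty far]) (assumption, rule that, assumption+)
  define \<psi> where "\<psi> t = blinfun_apply (- y) (f (u + t *\<^sub>R d))" for t :: real
  have "\<psi> 1 - \<psi> 0 \<le> - (\<alpha> * norm d)"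
  proof (rule Dini_mean_value_inequality)
    show "continuous_on {0..1} \<psi>"
      unfolding \<psi>_def
      by (intro continuous_intros continuous_on_compose2[OF cont]) auto
    fix t :: real assume t: "0 \<le> t" "t < 1"
    define z where "z = u + t *\<^sub>R d"
    have "z = (1 - t) *\<^sub>R u + t *\<^sub>R v" by (simp add: z_def d_def algebra_simps)
    then have z: "z \<in> S" using convexD_alt[OF S uv, of t] t by simp
    have "Limsup (at_right 0) (\<lambda>h. ereal ((\<psi> (t + h) - \<psi> t) / h))
        = upper_dini_deriv (blinfun_apply (- y) \<circ> f) z d"
      by (simp add: upper_dini_deriv_def \<psi>_def z_def algebra_simps)
    also have "\<dots> \<le> (SUP T\<in>Jf z. ereal (blinfun_apply (- y) (blinfun_apply T d)))"
      using pj by (simp add: pseudo_Jacobian_mapping_def pseudo_Jacobian_def)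
    also have "\<dots> \<le> ereal (- (\<alpha> * norm d))"
      using sub[OF z] y(2) by (intro SUP_least) (auto simp: C_def blinfun.minus_left)
    finally show "Limsup (at_right 0) (\<lambda>h. ereal ((\<psi> (t + h) - \<psi> t) / h)) \<le> ereal (- (\<alpha> * norm d))" .
  qed
  then have "\<alpha> * norm d \<le> blinfun_apply y (f v - f u)"
    by (simp add: \<psi>_def d_def blinfun.minus_left blinfun.diff_right)
  also have "\<dots> \<le> norm (f v - f u)" by (rule y(1))
  finally show False using less by (simp add: d_def dist_norm norm_minus_commute)
qed

text \<open>A subgradient of the distance to \<open>y\<close> has norm at most one and attains the norm of \<open>v - y\<close>.\<close>

lemma distance_subgradient:
  assumes "ystar \<in> clarke_subdifferential (dist_to y) v"
  shows "blinfun_apply ystar h \<le> norm h" "norm (v - y) \<le> blinfun_apply ystar (v - y)"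
proof -
  have sub: "norm (v - y) + blinfun_apply ystar (w - v) \<le> norm (w - y)" for w
    using assms by (simp add: clarke_subdifferential_dist_to)
  show "blinfun_apply ystar h \<le> norm h"
    using sub[of "v + h"] norm_triangle_ineq[of "v - y" h] by (simp add: algebra_simps)
  show "norm (v - y) \<le> blinfun_apply ystar (v - y)"
    using sub[of y] by (simp add: blinfun.diff_right)
qed

text \<open>The test vector is the preimage \<open>u\<close> of \<open>w = f x - y\<close> under an operator \<open>S\<close> of the convex hull
  itself: \<open>ystar\<close> attains the norm of \<open>w\<close>, which is at least \<open>\<alpha> * norm u\<close>. An operator of the
  closure is approximated by such an \<open>S\<close>, which costs the gap between \<open>\<epsilon>\<close> and \<open>\<alpha>\<close>.\<close>

lemma chain_set_not_small:
  fixes f :: "'a::real_normed_vector \<Rightarrow> 'b::real_normed_vector"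
  assumes coercive: "coercive_isomorphisms (convex hull (Jf x)) \<alpha>" and \<epsilon>: "0 < \<epsilon>" "\<epsilon> < \<alpha>"
    and y: "y \<noteq> f x" and a: "a \<in> chain_set f Jf x y"
  shows "\<exists>u. \<epsilon> * norm u < blinfun_apply a u"
proof -
  obtain ystar T where aT: "a = ystar o\<^sub>L T"
    and ys: "ystar \<in> clarke_subdifferential (dist_to y) (f x)"
    and T: "T \<in> closure (convex hull (Jf x))"
    using a by (auto simp: chain_set_def)
  obtain S where S: "S \<in> convex hull (Jf x)" "dist S T < \<alpha> - \<epsilon>"
    using T \<epsilon> unfolding closure_approachable by (meson diff_gt_0_iff_gt)
  define w where "w = f x - y"
  have w: "w \<noteq> 0" using y by (simp add: w_def)
  have "surj (blinfun_apply S)" using coercive S(1) by (simp add: coercive_isomorphisms_def)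
  then obtain u where u: "blinfun_apply S u = w" by (metis surjD)
  then have u0: "0 < norm u" using w by (auto simp: blinfun.zero_right)
  have "\<alpha> * norm u \<le> norm w"
    using coercive S(1) u by (auto simp: coercive_isomorphisms_def)
  also have "norm w \<le> blinfun_apply ystar w"
    using distance_subgradient(2)[OF ys] by (simp add: w_def)
  also have "\<dots> = blinfun_apply a u + blinfun_apply ystar (blinfun_apply (S - T) u)"
    by (simp add: aT u[symmetric] blinfun.diff_left blinfun.diff_right)
  also have "blinfun_apply ystar (blinfun_apply (S - T) u) \<le> norm (S - T) * norm u"
    using distance_subgradient(1)[OF ys] norm_blinfun order_trans by blast
  also have "\<dots> < (\<alpha> - \<epsilon>) * norm u"
    using S(2) u0 by (simp add: dist_norm)
  finally show ?thesis by (intro exI[of _ u]) (simp add: algebra_simps)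
qed

text \<open>If the distance to \<open>y\<close> decreased at a rate of at most \<open>\<epsilon>\<close> in every direction, the chain set,
  being a weak-star closed convex pseudo-Jacobian, would contain a functional of norm at most \<open>\<epsilon>\<close>,
  which the previous lemma excludes. A single direction of fast descent is what has to be
  extracted here, although each functional of the chain set has its own.\<close>

lemma chain_rule_steep_descent:
  fixes f :: "'a::real_normed_vector \<Rightarrow> 'b::real_normed_vector"
  assumes chain: "chain_rule_condition f Jf UNIV"
    and coercive: "coercive_isomorphisms (convex hull (Jf x)) \<alpha>" and \<epsilon>: "0 < \<epsilon>" "\<epsilon> < \<alpha>"
    and y: "y \<noteq> f x"
  shows "\<exists>u. upper_dini_deriv (dist_to y \<circ> f) x u < ereal (- \<epsilon> * norm u)"
proof (rule ccontr)
  assume flat: "\<not> ?thesis"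
  define A where "A = chain_set f Jf x y"
  have A: "closedin strong_operator_topology A" "convex A" "pseudo_Jacobian (dist_to y \<circ> f) x A"
    using chain y by (auto simp: chain_rule_condition_def A_def)
  obtain a where a: "a \<in> A" "\<And>u. blinfun_apply a u \<le> \<epsilon> * norm u"
  proof (rule weak_star_small_element[OF A(1,2)])
    show "A \<noteq> {}" using A(3) by (simp add: pseudo_Jacobian_def)
    fix u m
    assume m: "\<And>a. a \<in> A \<Longrightarrow> blinfun_apply a u \<le> m"
    \<comment> \<open>For a real-valued map the pseudo-Jacobian inequality is used with
          the identity of the reals as the functional.\<close>
    have "ereal (- \<epsilon> * norm u) \<le> upper_dini_deriv (dist_to y \<circ> f) x u"
      using flat by (meson not_less)
    also have "\<dots> = upper_dini_deriv (blinfun_apply id_blinfun \<circ> (dist_to y \<circ> f)) x u"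
      by (simp add: upper_dini_deriv_def)
    also have "\<dots> \<le> (SUP a\<in>A. ereal (blinfun_apply id_blinfun (blinfun_apply a u)))"
      using A(3) by (simp only: pseudo_Jacobian_def)
    also have "\<dots> \<le> ereal m" using m by (intro SUP_least) simp
    finally show "- \<epsilon> * norm u \<le> m" by simp
  qed (use \<epsilon> in auto)
  then show False
    using chain_set_not_small[where f = f and Jf = Jf and x = x, OF coercive \<epsilon> y, of a] by (auto simp: A_def not_less[symmetric])
qed

text \<open>Solve \<open>f z = y\<close> by minimizing the distance to \<open>y\<close>. Ekeland's principle provides a point \<open>z\<close> from
  which this distance decreases nowhere faster than at a rate \<open>\<epsilon> < \<alpha>\<close>; when the distance at \<open>z\<close> is not
  zero, this contradicts the steep descent.\<close>

lemma chain_rule_open: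
  fixes f :: "'a::banach \<Rightarrow> 'b::real_normed_vector"
  assumes cont: "continuous_on UNIV f" and chain: "chain_rule_condition f Jf UNIV"
    and coercive: "\<And>x. x \<in> ball u s \<Longrightarrow> coercive_isomorphisms (convex hull (Jf x)) \<alpha>" and \<alpha>: "0 < \<alpha>"
  shows "ball (f u) (\<alpha> * s) \<subseteq> f ` ball u s"
proof
  fix y assume "y \<in> ball (f u) (\<alpha> * s)"
  then have y: "norm (f u - y) < \<alpha> * s" by (simp add: dist_norm)
  have s: "0 < s"
    using le_less_trans[OF norm_ge_zero y] \<alpha> by (simp add: zero_less_mult_iff)
  \<comment> \<open>Room is needed twice: \<open>\<epsilon> < \<alpha>\<close> for the steep descent, and a radius \<open>r < s\<close> that still
      exceeds \<open>norm (f u - y) / \<epsilon>\<close>, so that the point supplied by Ekeland's principle lies in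
      the open ball and may be moved in all directions.\<close>
  have "norm (f u - y) / s < \<alpha>" using y s by (simp add: field_simps)
  then obtain \<epsilon> where \<epsilon>: "norm (f u - y) / s < \<epsilon>" "\<epsilon> < \<alpha>"
    using dense by blast
  have "0 \<le> norm (f u - y) / s" using s by simp
  then have \<epsilon>0: "0 < \<epsilon>" using \<epsilon>(1) by linarith
  have "norm (f u - y) / \<epsilon> < s" using \<epsilon> \<epsilon>0 s by (simp add: field_simps)
  then obtain r where r: "norm (f u - y) / \<epsilon> < r" "r < s" using dense by blast
  define \<phi> where "\<phi> = dist_to y \<circ> f"
  have r': "\<phi> u < \<epsilon> * r" using r(1) \<epsilon>0 by (simp add: \<phi>_def dist_to_def field_simps)
  have "0 \<le> norm (f u - y) / \<epsilon>" using \<epsilon>0 by simp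
  then have "0 < r" using r(1) by linarith
  have contphi: "continuous_on (cball u r) \<phi>"
    unfolding \<phi>_def dist_to_def o_def
    by (intro continuous_intros continuous_on_subset[OF cont]) auto
  obtain z where z: "z \<in> cball u r" "\<epsilon> * dist u z \<le> \<phi> u - \<phi> z"
    "\<And>x. x \<in> cball u r \<Longrightarrow> \<phi> z - \<epsilon> * dist z x \<le> \<phi> x"
  proof (rule Ekeland_variational_principle[OF _ contphi])
    show "complete (cball u r)" by (simp add: complete_eq_closed)
    show "u \<in> cball u r" using \<open>0 < r\<close> by simp
  qed (use \<epsilon>0 in \<open>auto simp: \<phi>_def dist_to_def\<close>)
  have "0 \<le> \<phi> z" by (simp add: \<phi>_def dist_to_def)
  then have "\<epsilon> * dist u z < \<epsilon> * r" using z(2) r' by linarith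
  then have zr: "dist u z < r" using \<epsilon>0 by simp
  have zs: "z \<in> ball u s" using zr r(2) by simp
  have "y = f z"
  proof (rule ccontr)
    assume "y \<noteq> f z"
    then obtain v where v: "upper_dini_deriv \<phi> z v < ereal (- \<epsilon> * norm v)"
      using chain_rule_steep_descent[OF chain coercive[OF zs] \<epsilon>0 \<epsilon>(2)] by (auto simp: \<phi>_def)
    have "((\<lambda>t. dist u (z + t *\<^sub>R v)) \<longlongrightarrow> dist u (z + 0 *\<^sub>R v)) (at_right 0)"
      by (intro tendsto_intros)
    then have "\<forall>\<^sub>F t in at_right 0. dist u (z + t *\<^sub>R v) < r"
      using zr by (intro order_tendstoD(2)) auto
    moreover have "\<forall>\<^sub>F t in at_right 0. (0::real) < t" by (rule eventually_at_right_less)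
    moreover have "\<forall>\<^sub>F t in at_right 0. ereal ((\<phi> (z + t *\<^sub>R v) - \<phi> z) / t) < ereal (- \<epsilon> * norm v)"
      using v unfolding upper_dini_deriv_def by (rule Limsup_lessD)
    ultimately have "\<forall>\<^sub>F t in at_right (0::real). False"
    proof eventually_elim
      case (elim t)
      have "\<phi> z - \<epsilon> * dist z (z + t *\<^sub>R v) \<le> \<phi> (z + t *\<^sub>R v)"
        using elim(1) by (intro z(3)) simp
      then show ?case using elim(2,3) by (simp add: dist_norm field_simps)
    qed
    then show False by simp
  qed
  with zs show "y \<in> f ` ball u s" by blast
qed

theorem regular_pseudo_Jacobian_expands_openly:
  fixes f :: "'a::banach \<Rightarrow> 'b::real_normed_vector"
  assumes "continuous_on UNIV f" "pseudo_Jacobian_mapping f Jf UNIV" "chain_rule_condition f Jf UNIV"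
    and S: "convex S" and coercive: "coercive_isomorphisms (convex hull (\<Union>z\<in>S. Jf z)) \<alpha>" and "0 < \<alpha>"
  shows "expands_openly f \<alpha> S"
  unfolding expands_openly_def
proof (intro conjI ballI allI impI)
  show "\<alpha> * dist u v \<le> dist (f u) (f v)" if "u \<in> S" "v \<in> S" for u v
    using coercive that
    by (intro pseudo_Jacobian_expanding[OF assms(1,2) S]) (auto simp: coercive_isomorphisms_def)
  fix u s assume "ball u s \<subseteq> S"
  then have "convex hull (Jf x) \<subseteq> convex hull (\<Union>z\<in>S. Jf z)" if "x \<in> ball u s" for x
    using that by (intro hull_mono) auto
  then show "ball (f u) (\<alpha> * s) \<subseteq> f ` ball u s"
    by (intro chain_rule_open[OF assms(1,3) _ \<open>0 < \<alpha>\<close>] coercive_isomorphisms_subset[OF coercive])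
qed

section \<open>Lifting segments\<close>

lemma expands_openly_subset:
  "expands_openly f \<alpha> S \<Longrightarrow> R \<subseteq> S \<Longrightarrow> expands_openly f \<alpha> R"
  unfolding expands_openly_def by (meson subsetD order_trans)

lemma expands_openly_dist:
  "expands_openly f \<alpha> S \<Longrightarrow> u \<in> S \<Longrightarrow> v \<in> S \<Longrightarrow> \<alpha> * dist u v \<le> dist (f u) (f v)"
  by (simp add: expands_openly_def)

lemma expands_openly_inj_on: "expands_openly f \<alpha> S \<Longrightarrow> 0 < \<alpha> \<Longrightarrow> inj_on f S"
proof (rule inj_onI)
  fix u v assume "expands_openly f \<alpha> S" "0 < \<alpha>" "u \<in> S" "v \<in> S" "f u = f v"
  then have "\<alpha> * dist u v \<le> 0" using expands_openly_dist[of f \<alpha> S u v] by simp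
  with \<open>0 < \<alpha>\<close> show "u = v" by (simp add: mult_le_0_iff)
qed

lemma expands_openly_preimage:
  assumes "expands_openly f \<alpha> (ball x r)" "dist (f x) y < \<alpha> * r"
  obtains z where "z \<in> ball x r" "f z = y"
  using assms unfolding expands_openly_def by (metis imageE mem_ball order_refl subsetD)

text \<open>The Lebesgue number of a cover by open sets on which \<open>f\<close> expands.\<close>

lemma expands_openly_compact_uniform_radius:
  assumes Q: "compact Q" and loc: "\<And>x. x \<in> Q \<Longrightarrow> \<exists>r>0. expands_openly f \<alpha> (ball x r)"
  shows "\<exists>r>0. \<forall>x\<in>Q. expands_openly f \<alpha> (ball x r)"
proof -
  define \<G> where "\<G> = {G. open G \<and> expands_openly f \<alpha> G}"
  have cover: "Q \<subseteq> \<Union>\<G>"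
  proof
    fix x assume "x \<in> Q"
    then obtain r where "0 < r" "expands_openly f \<alpha> (ball x r)" using loc by blast
    then have "ball x r \<in> \<G>" "x \<in> ball x r" by (simp_all add: \<G>_def)
    then show "x \<in> \<Union>\<G>" by blast
  qed
  have "open G" if "G \<in> \<G>" for G using that by (simp add: \<G>_def)
  from Heine_Borel_lemma[OF Q cover this] obtain r
    where r: "0 < r" "\<And>x. x \<in> Q \<Longrightarrow> \<exists>G\<in>\<G>. ball x r \<subseteq> G"
    by metis
  have "expands_openly f \<alpha> (ball x r)" if x: "x \<in> Q" for x
  proof -
    obtain G where "G \<in> \<G>" "ball x r \<subseteq> G" using r(2)[OF x] by blast
    then show ?thesis
      using expands_openly_subset[of f \<alpha> G] by (simp add: \<G>_def)
  qed
  with r(1) show ?thesis by blast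
qed

lemma locally_injective_lift_unique:
  fixes f :: "'a::metric_space \<Rightarrow> 'b" and q q' :: "'c::topological_space \<Rightarrow> 'a"
  assumes inj: "\<And>x. \<exists>r>0. inj_on f (ball x r)" and S: "connected S"
    and q: "continuous_on S q" "continuous_on S q'" and eq: "\<And>t. t \<in> S \<Longrightarrow> f (q t) = f (q' t)"
    and s: "s \<in> S" "q s = q' s" and t: "t \<in> S"
  shows "q t = q' t"
proof -
  define A where "A = {t \<in> S. q t = q' t}"
  have "closedin (top_of_set S) (S \<inter> (\<lambda>t. dist (q t) (q' t)) -` {0})"
    by (intro continuous_closedin_preimage continuous_intros q)
  also have "S \<inter> (\<lambda>t. dist (q t) (q' t)) -` {0} = A" by (auto simp: A_def)
  finally have closed: "closedin (top_of_set S) A" .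
  have "openin (top_of_set S) A"
  proof (subst openin_subopen, intro ballI)
    fix c assume c: "c \<in> A"
    obtain r where r: "0 < r" "inj_on f (ball (q c) r)" using inj by blast
    define W where "W = (S \<inter> q -` ball (q c) r) \<inter> (S \<inter> q' -` ball (q c) r)"
    have "openin (top_of_set S) W"
      unfolding W_def by (intro openin_Int continuous_openin_preimage_gen q) auto
    moreover have "c \<in> W" using c r by (auto simp: W_def A_def)
    moreover have "W \<subseteq> A"
      using r(2) eq by (auto simp: W_def A_def inj_on_def)
    ultimately show "\<exists>W. openin (top_of_set S) W \<and> c \<in> W \<and> W \<subseteq> A" by blast
  qed
  then have "A = {} \<or> A = S"
    using S closed unfolding connected_clopen by blast
  then show ?thesis using s t by (auto simp: A_def)
qed

text \<open>The segment from \<open>f x0\<close> to \<open>y\<close> has constant speed and reaches \<open>y\<close> at time one; \<open>b\<close> is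
  the time up to which it is lifted.\<close>

definition segment_lift ::
  "('a::real_normed_vector \<Rightarrow> 'b::real_normed_vector) \<Rightarrow> 'a \<Rightarrow> 'b \<Rightarrow> real \<Rightarrow> (real \<Rightarrow> 'a) \<Rightarrow> bool" where
  "segment_lift f x0 y b q \<longleftrightarrow>
     continuous_on {0..b} q \<and> q 0 = x0 \<and>
     (\<forall>t\<in>{0..b}. f (q t) = f x0 + t *\<^sub>R (y - f x0))"

lemma segment_lift_unique:
  assumes inj: "\<And>x. \<exists>r>0. inj_on f (ball x r)"
    and q: "segment_lift f x0 y b q" "segment_lift f x0 y c q'" and t: "0 \<le> t" "t \<le> b" "t \<le> c"
  shows "q t = q' t"
proof (rule locally_injective_lift_unique[where f = f and q = q and q' = q' and S = "{0..t}" and s = 0, OF inj])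
  have "continuous_on {0..b} q" "continuous_on {0..c} q'"
    using q by (auto simp: segment_lift_def)
  moreover have "{0..t} \<subseteq> {0..b}" "{0..t} \<subseteq> {0..c}" using t by auto
  ultimately show "continuous_on {0..t} q" "continuous_on {0..t} q'"
    using continuous_on_subset by blast+
  show "f (q s) = f (q' s)" if "s \<in> {0..t}" for s
    using q t that by (simp add: segment_lift_def)
  show "q 0 = q' 0" using q by (simp add: segment_lift_def)
qed (use t in auto)

lemma segment_dist:
  fixes a b :: "'b::real_normed_vector"
  shows "dist (a + s *\<^sub>R (b - a)) (a + t *\<^sub>R (b - a)) = \<bar>s - t\<bar> * dist a b"
proof -
  have "a + s *\<^sub>R (b - a) - (a + t *\<^sub>R (b - a)) = (s - t) *\<^sub>R (b - a)"
    by (simp add: algebra_simps)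
  then show ?thesis by (simp add: dist_norm norm_minus_commute)
qed

text \<open>Lifts agree where they overlap, so they glue to one on the union of their domains. The common
  Lipschitz constant is what allows an extension to the closure in a complete space: this is where
  a uniform lower bound on the expansion is needed, as a lift could otherwise escape to infinity
  before the end of the segment.\<close>

lemma segment_lift_extend_to_Sup:
  fixes f :: "'a::banach \<Rightarrow> 'b::real_normed_vector"
  assumes cont: "continuous_on UNIV f" and inj: "\<And>x. \<exists>r>0. inj_on f (ball x r)"
    and B: "B \<noteq> {}" "B \<subseteq> {0..}" "bdd_above B"
    and q: "\<And>b. b \<in> B \<Longrightarrow> segment_lift f x0 y b (q b) \<and> L-lipschitz_on {0..b} (q b)"
  obtains p where "segment_lift f x0 y (Sup B) p" "L-lipschitz_on {0..Sup B} p"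
proof -
  define U where "U = (\<Union>b\<in>B. {0..b})"
  define p where "p t = q (SOME b. b \<in> B \<and> t \<le> b) t" for t
  have p: "p t = q b t" if "b \<in> B" "0 \<le> t" "t \<le> b" for b t
  proof -
    define c where "c = (SOME b. b \<in> B \<and> t \<le> b)"
    have "\<exists>b. b \<in> B \<and> t \<le> b" using that by blast
    then have c: "c \<in> B \<and> t \<le> c" unfolding c_def by (rule someI_ex)
    have "q c t = q b t"
      using c that
      by (intro segment_lift_unique[OF inj conjunct1[OF q[of c]] conjunct1[OF q[of b]]]) auto
    then show ?thesis by (simp add: p_def c_def)
  qed
  have L: "0 \<le> L"
  proof -
    obtain b where "b \<in> B" using B(1) by blast
    then show ?thesis using q lipschitz_on_nonneg by metis
  qed
  have "L-lipschitz_on U p"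
  proof (rule lipschitz_on_leI[OF _ L])
    fix s t assume "s \<in> U" "t \<in> U" "s \<le> t"
    then obtain b where b: "b \<in> B" "0 \<le> s" "s \<le> t" "t \<le> b" by (auto simp: U_def)
    have "dist (q b s) (q b t) \<le> L * dist s t"
      using q[OF b(1)] b by (intro lipschitz_onD[of L "{0..b}"]) auto
    then show "dist (p s) (p t) \<le> L * dist s t"
      using b p[of b s] p[of b t] by simp
  qed
  then obtain P where P: "L-lipschitz_on (closure U) P" "\<And>t. t \<in> U \<Longrightarrow> P t = p t"
    using lipschitz_extend_closure by blast
  have "{0..<Sup B} \<subseteq> U"
    using less_cSup_iff[OF B(1,3)] by (fastforce simp: U_def)
  moreover have "0 \<in> U" using B(1,2) by (fastforce simp: U_def)
  ultimately have sub: "{0..Sup B} \<subseteq> closure U"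
  proof (cases "Sup B \<le> 0")
    case True
    then have "{0..Sup B} \<subseteq> {0}" by auto
    then show ?thesis using \<open>0 \<in> U\<close> closure_subset[of U] by blast
  next
    case False
    then have "closure {0..<Sup B} = {0..Sup B}"
      by (intro closure_atLeastLessThan) simp
    then show ?thesis using closure_mono[OF \<open>{0..<Sup B} \<subseteq> U\<close>] by simp
  qed
  have contP: "continuous_on (closure U) P"
    using P(1) by (rule lipschitz_on_continuous_on)
  have "f (P t) - (f x0 + t *\<^sub>R (y - f x0)) = 0" if "t \<in> closure U" for t
  proof (rule continuous_constant_on_closure[OF _ _ that])
    show "continuous_on (closure U) (\<lambda>t. f (P t) - (f x0 + t *\<^sub>R (y - f x0)))"
      by (intro continuous_intros contP continuous_on_compose2[OF cont contP]) auto
    fix t assume t: "t \<in> U"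
    then obtain b where "b \<in> B" "0 \<le> t" "t \<le> b" by (auto simp: U_def)
    then show "f (P t) - (f x0 + t *\<^sub>R (y - f x0)) = 0"
      using q[of b] p[of b t] P(2)[OF t] by (auto simp: segment_lift_def)
  qed
  then have onP: "f (P t) = f x0 + t *\<^sub>R (y - f x0)" if "t \<in> {0..Sup B}" for t
    using sub that by auto
  have "P 0 = x0"
  proof -
    obtain b where "b \<in> B" "0 \<le> b" using B(1,2) by auto
    then show ?thesis
      using q[of b] p[of b 0] P(2)[OF \<open>0 \<in> U\<close>] by (auto simp: segment_lift_def)
  qed
  then have "segment_lift f x0 y (Sup B) P"
    using onP continuous_on_subset[OF contP sub] by (simp add: segment_lift_def)
  moreover have "L-lipschitz_on {0..Sup B} P"
    using P(1) sub by (rule lipschitz_on_subset)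
  ultimately show ?thesis by (rule that)
qed

text \<open>The inverse of \<open>f\<close> on the ball around \<open>f (q c)\<close> continues the lift and keeps the Lipschitz
  constant \<open>L\<close>, as the segment has speed at most \<open>\<alpha> * L\<close>.\<close>

lemma segment_lift_extend_beyond:
  fixes f :: "'a::real_normed_vector \<Rightarrow> 'b::real_normed_vector"
  assumes \<alpha>: "0 < \<alpha>" and L: "dist (f x0) y \<le> \<alpha> * L"
    and c: "0 \<le> c" and q: "segment_lift f x0 y c q" "L-lipschitz_on {0..c} q"
    and r: "0 < r" "expands_openly f \<alpha> (ball (q c) r)"
  shows "\<exists>h0>0. \<forall>h\<in>{0..h0}. \<exists>p. segment_lift f x0 y (c + h) p \<and> L-lipschitz_on {0..c + h} p"
proof -
  define \<gamma> where "\<gamma> t = f x0 + t *\<^sub>R (y - f x0)" for t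
  have \<gamma>_dist: "dist (\<gamma> s) (\<gamma> t) = \<bar>s - t\<bar> * dist (f x0) y" for s t
    unfolding \<gamma>_def by (rule segment_dist)
  have fqc: "f (q c) = \<gamma> c" using q c by (simp add: segment_lift_def \<gamma>_def)
  \<comment> \<open>Chosen so that the segment, starting at \<open>f (q c)\<close>, stays in the ball of radius
      \<open>\<alpha> * r\<close> for the time \<open>h0\<close>; adding one avoids a division by zero for a constant segment.\<close>
  define h0 where "h0 = \<alpha> * r / (dist (f x0) y + 1)"
  have D: "0 < dist (f x0) y + 1" by (simp add: add_nonneg_pos)
  have h0: "0 < h0" using \<alpha> r(1) D by (simp add: h0_def)
  have close: "dist (f (q c)) (\<gamma> t) < \<alpha> * r" if "t \<in> {c..c + h0}" for t
  proof -
    have "dist (f (q c)) (\<gamma> t) = (t - c) * dist (f x0) y" using that by (simp add: fqc \<gamma>_dist)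
    also have "\<dots> \<le> h0 * dist (f x0) y" using that by (intro mult_right_mono) auto
    also have "\<dots> < h0 * (dist (f x0) y + 1)" using h0 by simp
    also have "\<dots> = \<alpha> * r" using D by (simp add: h0_def)
    finally show ?thesis .
  qed
  have "\<exists>z\<in>ball (q c) r. f z = \<gamma> t" if "t \<in> {c..c + h0}" for t
    using expands_openly_preimage[OF r(2) close[OF that]] by blast
  then obtain z where z: "\<And>t. t \<in> {c..c + h0} \<Longrightarrow> z t \<in> ball (q c) r"
    "\<And>t. t \<in> {c..c + h0} \<Longrightarrow> f (z t) = \<gamma> t"
    by metis
  have zc: "q c = z c"
    using expands_openly_inj_on[OF r(2) \<alpha>] z[of c] h0 r(1) by (auto simp: fqc inj_on_def)
  have L0: "0 \<le> L" using q(2) by (rule lipschitz_on_nonneg)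
  have lipz: "L-lipschitz_on {c..c + h0} z"
  proof (rule lipschitz_onI[OF _ L0])
    fix s t assume st: "s \<in> {c..c + h0}" "t \<in> {c..c + h0}"
    have "\<alpha> * dist (z s) (z t) \<le> dist (f (z s)) (f (z t))"
      using r(2) z(1) st by (intro expands_openly_dist) auto
    also have "\<dots> = \<bar>s - t\<bar> * dist (f x0) y" using st by (simp add: z(2) \<gamma>_dist)
    also have "\<dots> \<le> \<bar>s - t\<bar> * (\<alpha> * L)" using L by (intro mult_left_mono) auto
    also have "\<dots> = \<alpha> * (L * dist s t)" by (simp add: dist_real_def)
    finally show "dist (z s) (z t) \<le> L * dist s t" using \<alpha> by simp
  qed
  define p where "p t = (if t \<le> c then q t else z t)" for t
  have "segment_lift f x0 y (c + h) p \<and> L-lipschitz_on {0..c + h} p" if h: "h \<in> {0..h0}" for h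
  proof
    have "L-lipschitz_on {c..c + h} z"
      using lipz by (rule lipschitz_on_subset) (use h in auto)
    then show lip: "L-lipschitz_on {0..c + h} p"
      unfolding p_def by (intro lipschitz_on_concat q(2) zc)
    show "segment_lift f x0 y (c + h) p"
      unfolding segment_lift_def
    proof (intro conjI ballI)
      show "p 0 = x0" using c q by (simp add: p_def segment_lift_def)
      show "continuous_on {0..c + h} p" using lip by (rule lipschitz_on_continuous_on)
      fix t assume "t \<in> {0..c + h}"
      then show "f (p t) = f x0 + t *\<^sub>R (y - f x0)"
        using q(1) z(2)[of t] h by (auto simp: p_def segment_lift_def \<gamma>_def)
    qed
  qed
  then show ?thesis using h0 by blast
qed

text \<open>The parameters up to which a lift exists form an interval that contains its supremum and can be
  prolonged from any point below one.\<close>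

lemma segment_lift_exists:
  fixes f :: "'a::banach \<Rightarrow> 'b::real_normed_vector"
  assumes cont: "continuous_on UNIV f" and inj: "\<And>x. \<exists>r>0. inj_on f (ball x r)" and \<alpha>: "0 < \<alpha>"
    and exp: "\<And>x. f x \<in> closed_segment (f x0) y \<Longrightarrow> \<exists>r>0. expands_openly f \<alpha> (ball x r)"
  shows "\<exists>q. segment_lift f x0 y 1 q"
proof -
  define L where "L = dist (f x0) y / \<alpha>"
  have L: "dist (f x0) y \<le> \<alpha> * L" "0 \<le> L" using \<alpha> by (auto simp: L_def)
  define B where "B = {b \<in> {0..1}. \<exists>q. segment_lift f x0 y b q \<and> L-lipschitz_on {0..b} q}"
  have "segment_lift f x0 y 0 (\<lambda>_. x0)" "L-lipschitz_on {0..0} (\<lambda>_. x0)"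
    using L by (auto simp: segment_lift_def lipschitz_on_def)
  then have "0 \<in> B" by (auto simp: B_def simp del: atLeastAtMost_singleton)
  have bdd: "bdd_above B" by (rule bdd_aboveI[of _ 1]) (simp add: B_def)
  have "\<exists>q. segment_lift f x0 y b q \<and> L-lipschitz_on {0..b} q" if "b \<in> B" for b
    using that by (simp add: B_def)
  then obtain q where q: "\<And>b. b \<in> B \<Longrightarrow> segment_lift f x0 y b (q b) \<and> L-lipschitz_on {0..b} (q b)"
    by metis
  define c where "c = Sup B"
  have "B \<noteq> {}" using \<open>0 \<in> B\<close> by blast
  moreover have "B \<subseteq> {0..}" by (auto simp: B_def)
  ultimately obtain p where p: "segment_lift f x0 y c p" "L-lipschitz_on {0..c} p"
    unfolding c_def by (rule segment_lift_extend_to_Sup[OF cont inj _ _ bdd q]) blast+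
  have c: "0 \<le> c" "c \<le> 1"
    unfolding c_def using cSup_upper[OF \<open>0 \<in> B\<close> bdd] cSup_least[OF \<open>B \<noteq> {}\<close>, of 1]
    by (auto simp: B_def)
  have "c = 1"
  proof (rule ccontr)
    assume "c \<noteq> 1"
    have "f (p c) = (1 - c) *\<^sub>R f x0 + c *\<^sub>R y"
      using p(1) c by (simp add: segment_lift_def algebra_simps)
    then have "f (p c) \<in> closed_segment (f x0) y"
      using c by (auto simp: closed_segment_def)
    then obtain r where "0 < r" "expands_openly f \<alpha> (ball (p c) r)"
      using exp by blast
    from segment_lift_extend_beyond[OF \<alpha> L(1) c(1) p this] obtain h0 where h0: "0 < h0"
      "\<And>h. h \<in> {0..h0} \<Longrightarrow> \<exists>p. segment_lift f x0 y (c + h) p \<and> L-lipschitz_on {0..c + h} p"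
      by blast
    define h where "h = min h0 (1 - c)"
    have h: "0 < h" "h \<in> {0..h0}" "c + h \<le> 1"
      using h0(1) c \<open>c \<noteq> 1\<close> by (auto simp: h_def)
    have "c + h \<in> B"
      unfolding B_def using h0(2)[OF h(2)] h c by simp
    then show False using cSup_upper[OF _ bdd] h by (fastforce simp: c_def)
  qed
  with p show ?thesis by auto
qed

text \<open>The lift towards a nearby end point \<open>y'\<close> is obtained from the given one by correcting each \<open>q t\<close>
  within its ball of radius \<open>r\<close>; a uniform radius makes this possible for all \<open>t\<close> at once. The
  corrected path is continuous because \<open>q' s\<close> and \<open>q' t\<close> lie in one common ball, on which \<open>f\<close>
  expands, when \<open>s\<close> is close to \<open>t\<close>.\<close>

lemma segment_lift_endpoint_stable:
  fixes f :: "'a::real_normed_vector \<Rightarrow> 'b::real_normed_vector"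
  assumes q: "segment_lift f x0 y 1 q" and \<alpha>: "0 < \<alpha>" and r: "0 < r"
    and exp: "\<And>t. t \<in> {0..1} \<Longrightarrow> expands_openly f \<alpha> (ball (q t) r)"
    and y': "dist y y' < \<alpha> * r"
  obtains q' where "segment_lift f x0 y' 1 q'" "\<alpha> * dist (q 1) (q' 1) \<le> dist y y'"
proof -
  define \<gamma> where "\<gamma> t = f x0 + t *\<^sub>R (y - f x0)" for t
  define \<gamma>' where "\<gamma>' t = f x0 + t *\<^sub>R (y' - f x0)" for t
  have fq: "f (q t) = \<gamma> t" if "t \<in> {0..1}" for t
    using q that by (simp add: segment_lift_def \<gamma>_def)
  have close: "dist (f (q t)) (\<gamma>' t) \<le> dist y y'" if t: "t \<in> {0..1}" for t
  proof -
    have "\<gamma> t - \<gamma>' t = t *\<^sub>R (y - y')" by (simp add: \<gamma>_def \<gamma>'_def algebra_simps)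
    then have "dist (f (q t)) (\<gamma>' t) = t * dist y y'" using t by (simp add: fq dist_norm)
    also have "\<dots> \<le> 1 * dist y y'" using t by (intro mult_right_mono) auto
    finally show ?thesis by simp
  qed
  have "\<exists>z\<in>ball (q t) r. f z = \<gamma>' t" if t: "t \<in> {0..1}" for t
  proof -
    have "dist (f (q t)) (\<gamma>' t) < \<alpha> * r" using close[OF t] y' by linarith
    from expands_openly_preimage[OF exp[OF t] this] show ?thesis by blast
  qed
  then obtain q' where q': "\<And>t. t \<in> {0..1} \<Longrightarrow> q' t \<in> ball (q t) r"
    "\<And>t. t \<in> {0..1} \<Longrightarrow> f (q' t) = \<gamma>' t"
    by metis
  have "q' 0 = x0"
  proof -
    have "q 0 = x0" using q by (simp add: segment_lift_def)
    then show ?thesis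
      using expands_openly_inj_on[OF exp \<alpha>, of 0] q'[of 0] r by (auto simp: inj_on_def \<gamma>'_def)
  qed
  moreover have "continuous_on {0..1} q'"
    unfolding continuous_on
  proof (intro ballI)
    fix t :: real assume t: "t \<in> {0..1}"
    have qt: "(q \<longlongrightarrow> q t) (at t within {0..1})"
      using q t by (simp add: segment_lift_def continuous_on)
    have "((\<lambda>s. dist (q s) (q' t)) \<longlongrightarrow> dist (q t) (q' t)) (at t within {0..1})"
      by (intro tendsto_intros qt)
    then have near: "\<forall>\<^sub>F s in at t within {0..1}. dist (q s) (q' t) < r"
      using q'(1)[OF t] by (intro order_tendstoD(2)) auto
    have mem: "\<forall>\<^sub>F s in at t within {0..1}. s \<in> {0..1}"
      by (auto simp: eventually_at_filter)
    have "((\<lambda>s. dist (\<gamma>' s) (\<gamma>' t) / \<alpha>) \<longlongrightarrow> dist (\<gamma>' t) (\<gamma>' t) / \<alpha>) (at t within {0..1})"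
      unfolding \<gamma>'_def using \<alpha> by (intro tendsto_intros) auto
    then have lim: "((\<lambda>s. dist (\<gamma>' s) (\<gamma>' t) / \<alpha>) \<longlongrightarrow> 0) (at t within {0..1})" by simp
    have le: "\<forall>\<^sub>F s in at t within {0..1}. norm (dist (q' s) (q' t)) \<le> dist (\<gamma>' s) (\<gamma>' t) / \<alpha>"
      using near mem
    proof eventually_elim
      case (elim s)
      have "\<alpha> * dist (q' s) (q' t) \<le> dist (f (q' s)) (f (q' t))"
        using q'(1)[OF elim(2)] elim by (intro expands_openly_dist[OF exp[OF elim(2)]]) auto
      then show ?case using \<alpha> q'(2) elim(2) t by (simp add: field_simps)
    qed
    have "((\<lambda>s. dist (q' s) (q' t)) \<longlongrightarrow> 0) (at t within {0..1})"
      by (rule Lim_null_comparison[OF le lim])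
    then show "(q' \<longlongrightarrow> q' t) (at t within {0..1})"
      by (rule iffD2[OF tendsto_dist_iff])
  qed
  ultimately have "segment_lift f x0 y' 1 q'"
    using q'(2) by (simp add: segment_lift_def \<gamma>'_def)
  moreover have "\<alpha> * dist (q 1) (q' 1) \<le> dist y y'"
  proof -
    have "\<alpha> * dist (q 1) (q' 1) \<le> dist (f (q 1)) (f (q' 1))"
      using q'(1)[of 1] r by (intro expands_openly_dist[OF exp[of 1]]) auto
    also have "\<dots> \<le> dist y y'" using close[of 1] q'(2)[of 1] by simp
    finally show ?thesis .
  qed
  ultimately show ?thesis by (rule that)
qed

section \<open>Global inversion\<close>

text \<open>End points of lifted segments define a continuous right inverse \<open>g\<close> of \<open>f\<close> on the whole of the
  target; the star shape of the target replaces homotopies of paths. It is also a left inverse: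
  the set of \<open>x\<close> with \<open>g (f x) = x\<close> is closed, it is open by local injectivity of \<open>f\<close>, and it is
  not empty, so it is the whole space, which is connected.\<close>

theorem locally_expanding_global_homeomorphism:
  fixes f :: "'a::banach \<Rightarrow> 'b::real_normed_vector"
  assumes cont: "continuous_on UNIV f"
    and exp: "\<And>K. compact K \<Longrightarrow> \<exists>\<alpha>>0. \<forall>x\<in>f -` K. \<exists>r>0. expands_openly f \<alpha> (ball x r)"
  shows "\<exists>g. homeomorphism UNIV UNIV f g"
proof -
  have inj: "\<exists>r>0. inj_on f (ball x r)" for x
    using exp[of "{f x}"] expands_openly_inj_on by fastforce
  define x0 :: 'a where "x0 = 0"
  have seg: "\<exists>\<alpha>>0. \<forall>x. f x \<in> closed_segment (f x0) y \<longrightarrow> (\<exists>r>0. expands_openly f \<alpha> (ball x r))" for y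
    using exp[of "closed_segment (f x0) y"] by auto
  have "\<exists>q. segment_lift f x0 y 1 q" for y
    using seg[of y] segment_lift_exists[OF cont inj] by blast
  then obtain q where q: "\<And>y. segment_lift f x0 y 1 (q y)" by metis
  define g where "g y = q y 1" for y
  have fg: "f (g y) = y" for y
    using q[of y] by (simp add: segment_lift_def g_def)
  have "isCont g y" for y
    unfolding isCont_def
  proof (rule tendstoI)
    obtain \<alpha> where \<alpha>: "0 < \<alpha>"
      "\<And>x. f x \<in> closed_segment (f x0) y \<Longrightarrow> \<exists>r>0. expands_openly f \<alpha> (ball x r)"
      using seg by blast
    have on_seg: "f (q y t) \<in> closed_segment (f x0) y" if "t \<in> {0..1}" for t
    proof -
      have "f (q y t) = (1 - t) *\<^sub>R f x0 + t *\<^sub>R y"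
        using q[of y] that by (simp add: segment_lift_def algebra_simps)
      then show ?thesis using that by (auto simp: closed_segment_def)
    qed
    have "compact (q y ` {0..1})"
      using q[of y] by (intro compact_continuous_image) (auto simp: segment_lift_def)
    moreover have "\<exists>r>0. expands_openly f \<alpha> (ball x r)" if "x \<in> q y ` {0..1}" for x
      using that on_seg \<alpha>(2) by blast
    ultimately have "\<exists>r>0. \<forall>x\<in>q y ` {0..1}. expands_openly f \<alpha> (ball x r)"
      by (rule expands_openly_compact_uniform_radius)
    then obtain r where r: "0 < r" "\<And>t. t \<in> {0..1} \<Longrightarrow> expands_openly f \<alpha> (ball (q y t) r)"
      by blast
    fix e :: real assume e: "0 < e"
    have "\<forall>\<^sub>F y' in at y. dist y' y < min (\<alpha> * r) (\<alpha> * e)"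
      unfolding eventually_at using \<alpha>(1) r(1) e
      by (intro exI[of _ "min (\<alpha> * r) (\<alpha> * e)"]) simp
    then show "\<forall>\<^sub>F y' in at y. dist (g y') (g y) < e"
    proof eventually_elim
      case (elim y')
      then have "dist y y' < \<alpha> * r" by (simp add: dist_commute)
      then obtain q' where q': "segment_lift f x0 y' 1 q'" "\<alpha> * dist (q y 1) (q' 1) \<le> dist y y'"
        using segment_lift_endpoint_stable[OF q \<alpha>(1) r] by metis
      have "q' 1 = g y'"
        unfolding g_def by (rule segment_lift_unique[OF inj q'(1) q]) auto
      then have "\<alpha> * dist (g y) (g y') < \<alpha> * e"
        using q'(2) elim by (simp add: g_def dist_commute)
      then show ?case using \<alpha>(1) by (simp add: dist_commute)
    qed
  qed
  then have contg: "continuous_on UNIV g" by (simp add: continuous_at_imp_continuous_on)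
  define A where "A = {x. g (f x) = x}"
  have contgf: "continuous_on UNIV (\<lambda>x. g (f x))"
    by (rule continuous_on_compose2[OF contg cont]) simp
  have "closed A"
    unfolding A_def by (intro closed_Collect_eq contgf continuous_on_id)
  moreover have "open A"
  proof (subst open_subopen, intro ballI)
    fix x assume x: "x \<in> A"
    obtain r where r: "0 < r" "inj_on f (ball x r)" using inj by blast
    define W where "W = ball x r \<inter> (\<lambda>x. g (f x)) -` ball x r"
    have "open W"
      unfolding W_def by (intro open_Int open_vimage contgf) auto
    moreover have "x \<in> W" using x r by (simp add: W_def A_def)
    moreover have "W \<subseteq> A"
      using r(2) by (auto simp: W_def A_def inj_on_def fg)
    ultimately show "\<exists>W. open W \<and> x \<in> W \<and> W \<subseteq> A" by blast
  qed
  moreover have "g (f x0) \<in> A" by (simp add: A_def fg)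
  ultimately have "A = UNIV" using clopen[of A] by blast
  then have "g (f x) = x" for x by (auto simp: A_def)
  then have "homeomorphism UNIV UNIV f g"
    using fg cont contg by (intro homeomorphismI) auto
  then show ?thesis by blast
qed

lemma expanding_homeomorphism_locally_Lipschitz_inverse:
  assumes hom: "homeomorphism UNIV UNIV f g"
    and exp: "\<And>x. \<exists>\<alpha>>0. \<exists>r>0. expands_openly f \<alpha> (ball x r)"
  shows "locally_Lipschitz g"
  unfolding locally_Lipschitz_def
proof
  fix y
  have gf: "g (f x) = x" and fg: "f (g y) = y" for x y
    using hom by (auto simp: homeomorphism_def)
  obtain \<alpha> r where \<alpha>: "0 < \<alpha>" and r: "0 < r" and E: "expands_openly f \<alpha> (ball (g y) r)"
    using exp by blast
  have near: "g z \<in> ball (g y) r" if "z \<in> ball y (\<alpha> * r)" for z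
  proof -
    have "dist (f (g y)) z < \<alpha> * r" using that by (simp add: fg)
    from expands_openly_preimage[OF E this] show ?thesis using gf by metis
  qed
  have "(1 / \<alpha>)-lipschitz_on (ball y (\<alpha> * r)) g"
  proof (rule lipschitz_onI)
    fix z w assume "z \<in> ball y (\<alpha> * r)" "w \<in> ball y (\<alpha> * r)"
    then have "\<alpha> * dist (g z) (g w) \<le> dist (f (g z)) (f (g w))"
      using near by (intro expands_openly_dist[OF E]) auto
    then show "dist (g z) (g w) \<le> 1 / \<alpha> * dist z w"
      using \<alpha> by (simp add: fg field_simps)
  qed (use \<alpha> in simp)
  then show "\<exists>s>0. \<exists>L. L-lipschitz_on (ball y s) g"
    using \<alpha> r by (intro exI[of _ "\<alpha> * r"]) auto
qed

section \<open>The regularity index\<close>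

lemma regularity_index_gt_ball:
  fixes Jf :: "'a::real_normed_vector \<Rightarrow> ('a \<Rightarrow>\<^sub>L 'b::real_normed_vector) set"
  assumes "\<alpha> < regularity_index Jf UNIV x"
  obtains r where "0 < r" "\<And>T. T \<in> convex hull (\<Union>z\<in>ball x r. Jf z) \<Longrightarrow> \<alpha> \<le> conorm T"
proof -
  obtain r where "0 < r" "\<alpha> < (INF T\<in>convex hull (\<Union>z\<in>ball x r. Jf z). conorm T)"
    using assms by (auto simp: regularity_index_def less_SUP_iff)
  then show ?thesis
    by (intro that[of r]) (auto intro: less_imp_le order.strict_trans2 INF_lower)
qed

lemma conorm_le:
  assumes "ereal \<alpha> \<le> conorm T"
  shows "\<alpha> * norm v \<le> norm (blinfun_apply T v)"
proof (cases "v = 0")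
  case False
  define e where "e = (1 / norm v) *\<^sub>R v"
  have "norm e = 1" using False by (simp add: e_def)
  then have "conorm T \<le> ereal (norm (blinfun_apply T e))"
    unfolding conorm_def by (intro INF_lower) simp
  with assms have "ereal \<alpha> \<le> ereal (norm (blinfun_apply T e))" by (rule order_trans)
  then show ?thesis
    using False by (simp add: e_def blinfun.scaleR_right field_simps)
qed simp

lemma regular_at_coercive_isomorphisms:
  fixes Jf :: "'a::real_normed_vector \<Rightarrow> ('a \<Rightarrow>\<^sub>L 'b::real_normed_vector) set"
  assumes reg: "regular_at Jf UNIV x" and \<alpha>: "ereal \<alpha> < regularity_index Jf UNIV x"
  shows "\<exists>r>0. coercive_isomorphisms (convex hull (\<Union>z\<in>ball x r. Jf z)) \<alpha>"
proof -
  obtain r where r: "0 < r" "\<And>T. T \<in> convex hull (\<Union>z\<in>ball x r. Jf z) \<Longrightarrow> ereal \<alpha> \<le> conorm T"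
    using regularity_index_gt_ball[OF \<alpha>] by blast
  obtain s where s: "0 < s" "\<And>T. T \<in> convex hull (\<Union>z\<in>ball x s. Jf z) \<Longrightarrow> blinfun_isomorphism T"
    using reg by (auto simp: regular_at_def)
  have "convex hull (\<Union>z\<in>ball x (min r s). Jf z) \<subseteq> convex hull (\<Union>z\<in>ball x r. Jf z)"
    "convex hull (\<Union>z\<in>ball x (min r s). Jf z) \<subseteq> convex hull (\<Union>z\<in>ball x s. Jf z)"
    by (intro hull_mono; auto)+
  then have "coercive_isomorphisms (convex hull (\<Union>z\<in>ball x (min r s). Jf z)) \<alpha>"
    using r(2) s(2) conorm_le unfolding coercive_isomorphisms_def blinfun_isomorphism_def bij_def
    by blast
  then show ?thesis using r(1) s(1) by (intro exI[of _ "min r s"]) simp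
qed

text \<open>A small ball around a point \<open>z\<close> of \<open>ball x r\<close> is contained in \<open>ball x r\<close>, so that the infimum of
  the co-norm over its convex hull is no smaller.\<close>

lemma regularity_index_locally_bounded_below:
  fixes Jf :: "'a::real_normed_vector \<Rightarrow> ('a \<Rightarrow>\<^sub>L 'b::real_normed_vector) set"
  assumes "\<alpha> < regularity_index Jf UNIV x"
  shows "\<exists>U. open U \<and> x \<in> U \<and> (\<forall>z\<in>U. \<alpha> \<le> regularity_index Jf UNIV z)"
proof -
  obtain r where r: "0 < r" "\<And>T. T \<in> convex hull (\<Union>z\<in>ball x r. Jf z) \<Longrightarrow> \<alpha> \<le> conorm T"
    using regularity_index_gt_ball[OF assms] by blast
  have "\<alpha> \<le> regularity_index Jf UNIV z" if z: "z \<in> ball x r" for z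
  proof -
    obtain s where s: "0 < s" "ball z s \<subseteq> ball x r"
      using z openE[OF open_ball] by metis
    then have "convex hull (\<Union>w\<in>ball z s. Jf w) \<subseteq> convex hull (\<Union>w\<in>ball x r. Jf w)"
      by (intro hull_mono) auto
    then have "\<alpha> \<le> (INF T\<in>convex hull (\<Union>w\<in>ball z s. Jf w). conorm T)"
      using r(2) by (intro INF_greatest) auto
    also have "\<dots> \<le> regularity_index Jf UNIV z"
      unfolding regularity_index_def using s(1) by (intro SUP_upper) auto
    finally show ?thesis .
  qed
  then show ?thesis using r(1) by (intro exI[of _ "ball x r"]) auto
qed

lemma compact_locally_bounded_below_INF_pos:
  fixes \<rho> :: "'a::topological_space \<Rightarrow> ereal"
  assumes C: "compact C"
    and loc: "\<And>x. x \<in> C \<Longrightarrow> \<exists>U \<alpha>. open U \<and> x \<in> U \<and> 0 < \<alpha> \<and> (\<forall>z\<in>U. \<alpha> \<le> \<rho> z)"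
  shows "0 < (INF x\<in>C. \<rho> x)"
proof -
  obtain U \<alpha> where U: "\<And>x. x \<in> C \<Longrightarrow> open (U x)" "\<And>x. x \<in> C \<Longrightarrow> x \<in> U x"
    and \<alpha>: "\<And>x. x \<in> C \<Longrightarrow> (0::ereal) < \<alpha> x" "\<And>x z. x \<in> C \<Longrightarrow> z \<in> U x \<Longrightarrow> \<alpha> x \<le> \<rho> z"
    using loc by metis
  obtain D where D: "D \<subseteq> C" "finite D" "C \<subseteq> (\<Union>x\<in>D. U x)"
    using compactE_image[OF C, of C U] U by blast
  define m where "m = Min (insert 1 (\<alpha> ` D))"
  have "0 < m" using D \<alpha>(1) by (auto simp: m_def)
  also have "m \<le> (INF x\<in>C. \<rho> x)"
  proof (rule INF_greatest)
    fix z assume "z \<in> C"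
    then obtain x where x: "x \<in> D" "z \<in> U x" using D by blast
    then have "m \<le> \<alpha> x" using D(2) by (auto simp: m_def)
    also have "\<dots> \<le> \<rho> z" using x D(1) by (intro \<alpha>(2)) auto
    finally show "m \<le> \<rho> z" .
  qed
  finally show ?thesis .
qed

section \<open>The equivalence\<close>

theorem theorem3p14:
  fixes f :: "'a::banach \<Rightarrow> 'b::banach"
    and Jf :: "'a \<Rightarrow> ('a \<Rightarrow>\<^sub>L 'b) set"
  assumes "continuous_on UNIV f"
    and "pseudo_Jacobian_mapping f Jf UNIV"
    and "chain_rule_condition f Jf UNIV"
    and "\<And>x. regular_at Jf UNIV x"
  shows "((\<exists>g. homeomorphism UNIV UNIV f g) \<longleftrightarrow>
           (\<forall>K. compact K \<longrightarrow> (INF x\<in>f -` K. regularity_index Jf UNIV x) > 0)) \<and>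
         ((\<forall>K. compact K \<longrightarrow> (INF x\<in>f -` K. regularity_index Jf UNIV x) > 0) \<longleftrightarrow>
           (\<exists>g. homeomorphism UNIV UNIV f g \<and> locally_Lipschitz g))"
proof -
  \<comment> \<open>Any positive number below the regularity index is an expansion factor near the point.\<close>
  have local: "\<exists>r>0. expands_openly f \<alpha> (ball x r)"
    if \<alpha>: "0 < \<alpha>" "ereal \<alpha> < regularity_index Jf UNIV x" for x \<alpha>
  proof -
    obtain r where "0 < r" "coercive_isomorphisms (convex hull (\<Union>z\<in>ball x r. Jf z)) \<alpha>"
      using regular_at_coercive_isomorphisms[OF assms(4) \<alpha>(2)] by blast
    with regular_pseudo_Jacobian_expands_openly[OF assms(1-3) convex_ball _ \<alpha>(1)]
    show ?thesis by metis
  qed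
  have pos: "\<exists>\<alpha>>0. ereal \<alpha> < \<rho>" if "0 < \<rho>" for \<rho>
    using ereal_dense2[OF that] by auto
  have ptwise: "\<exists>\<alpha>>0. \<exists>r>0. expands_openly f \<alpha> (ball x r)" for x
    using pos[of "regularity_index Jf UNIV x"] assms(4)[of x] local unfolding regular_at_def by blast
  have ab: "0 < (INF x\<in>f -` K. regularity_index Jf UNIV x)"
    if hom: "homeomorphism UNIV UNIV f g" and K: "compact K" for g K
  proof -
    have gf: "g (f x) = x" and fg: "f (g y) = y" for x y
      using hom by (auto simp: homeomorphism_def)
    have "f -` K = g ` K"
    proof (intro set_eqI iffI)
      show "x \<in> g ` K" if "x \<in> f -` K" for x
        using that gf[of x] by (metis image_eqI vimageE)
    qed (use fg in auto)
    moreover have "continuous_on K g"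
      using hom unfolding homeomorphism_def by (meson continuous_on_subset subset_UNIV)
    then have "compact (g ` K)" using K by (rule compact_continuous_image)
    ultimately have compact: "compact (f -` K)" by simp
    show ?thesis
    proof (rule compact_locally_bounded_below_INF_pos[OF compact])
      fix x
      have "0 < regularity_index Jf UNIV x" using assms(4) by (simp add: regular_at_def)
      then obtain \<alpha> where "0 < \<alpha>" "ereal \<alpha> < regularity_index Jf UNIV x" using pos by blast
      then show "\<exists>U \<alpha>. open U \<and> x \<in> U \<and> 0 < \<alpha> \<and> (\<forall>z\<in>U. \<alpha> \<le> regularity_index Jf UNIV z)"
        using regularity_index_locally_bounded_below[of "ereal \<alpha>" Jf x] by (metis ereal_less(2))
    qed
  qed
  have ba: "\<exists>g. homeomorphism UNIV UNIV f g"
    if b: "\<And>K. compact K \<Longrightarrow> 0 < (INF x\<in>f -` K. regularity_index Jf UNIV x)"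
  proof (rule locally_expanding_global_homeomorphism[OF assms(1)])
    fix K :: "'b set" assume "compact K"
    then obtain \<alpha> where \<alpha>: "0 < \<alpha>" "ereal \<alpha> < (INF x\<in>f -` K. regularity_index Jf UNIV x)"
      using pos[OF b] by blast
    then have "\<exists>r>0. expands_openly f \<alpha> (ball x r)" if "x \<in> f -` K" for x
      using that by (intro local) (auto intro: order.strict_trans2 INF_lower)
    with \<alpha>(1) show "\<exists>\<alpha>>0. \<forall>x\<in>f -` K. \<exists>r>0. expands_openly f \<alpha> (ball x r)" by blast
  qed
  have ac: "locally_Lipschitz g" if "homeomorphism UNIV UNIV f g" for g
    using that ptwise by (rule expanding_homeomorphism_locally_Lipschitz_inverse)
  show ?thesis using ab ba ac by blast
qed

end
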